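(* Let $P\subseteq\mathbb R^n$ be a lattice polytope, let $A_P$ be its semigroup algebra, and let $\mathcal H_P$ be its harmonic algebra. For $m,d\geq 0$ let $F_{m,d}\subseteq (A_P)_m$ be the subspace of elements $f(x_1,\dots,x_n)z^m$ such that the Laurent polynomial $f$ vanishes to order at least $d$ at $e=(1,\dots,1)$. Then $\mathcal H_P$ is isomorphic as a bigraded algebra to the associated graded algebra \[\operatorname{gr} A_P=\bigoplus_{m,d\geq 0} F_{m,d}/F_{m,d+1},\] with bigrading given by $(m,d)$.
   Context: Semigroup algebra: $A_P=\bigoplus_{m\geq 0}\bigoplus_{(p_1,\dots,p_n)\in (mP)\cap\mathbb Z^n}\mathbb C\,x_1^{p_1}\cdots x_n^{p_n}z^m\subseteq \mathbb C[x_1^{\pm1},\dots,x_n^{\pm1}][z]$, graded by the exponent $m$ of $z$; here $mP$ is the $m$-th dilate of $P$. The order of vanishing of a Laurent polynomial $f$ at a point $p$ is the smallest $d$ such that some partial derivative of $f$ of order $d$ is nonzero at $p$. The filtration satisfies $F_{m,d}\cdot F_{m',d'}\subseteq F_{m+m',d+d'}$, so $\operatorname{gr}A_P$ inherits a multiplication. Harmonic algebra: for a finite set $Z\subseteq\mathbb C^n$, let $I(Z)\subseteq\mathbb C[x_1,\dots,x_n]$ be the ideal of polynomials vanishing on $Z$, and let $\operatorname{gr}I(Z)$ be the ideal spanned by the top-degree homogeneous components $f_d$ of elements $f=f_0+f_1+\cdots+f_d\in I(Z)$ ($f_i$ homogeneous of degree $i$, $f_d\neq 0$). The harmonic space is $V_Z=\{g\in\mathbb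 C[x_1,\dots,x_n] : f(\partial/\partial x_1,\dots,\partial/\partial x_n)\,g=0 \text{ for all } f\in\operatorname{gr}I(Z)\}$, a graded subspace of dimension $|Z|$. The harmonic algebra is $\mathcal H_P=\bigoplus_{m\geq 0}V_{(mP)\cap\mathbb Z^n}$ with $(\mathcal H_P)_{m,d}=(V_{(mP)\cap\mathbb Z^n})_d$ (degree-$d$ homogeneous part), with multiplication induced by multiplication of polynomials (a product of an element in the $m$-th summand and one in the $m'$-th summand lies in the $(m+m')$-th summand); it is known to be a bigraded algebra. *)

theory Defs
  imports
    "HOL-Analysis.Analysis"
    "HOL-Library.Poly_Mapping"
    "HOL-Library.Set_Algebras"
    "HOL-Library.Extended_Nat"
    "HOL-Computational_Algebra.Polynomial"
    "HOL-Algebra.QuotRing"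
    "HOL-Algebra.Module"
begin

section \<open>Bigraded algebras over the complex numbers\<close>

definition univ_ring :: "'a::comm_ring_1 ring" where
  "univ_ring = \<lparr>carrier = UNIV, monoid.mult = (*), one = 1, ring.zero = 0, add = (+)\<rparr>"

record 'b bigraded = "(complex, 'b) module" +
  component :: "nat \<Rightarrow> nat \<Rightarrow> 'b set"

locale bigraded_algebra = algebra "univ_ring :: complex ring" A
  for A :: "'b bigraded" (structure) +
  assumes component_submodule:
      "submodule (component A m d) (univ_ring :: complex ring) A"
    and one_component: "\<one> \<in> component A 0 0"
    and mult_component:
      "\<lbrakk>x \<in> component A m d; y \<in> component A m' d'\<rbrakk>
        \<Longrightarrow> x \<otimes> y \<in> component A (m + m') (d + d')"
    and direct_sum:
      "x \<in> carrier A \<Longrightarrow>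
        \<exists>!c :: nat \<times> nat \<Rightarrow> 'b.
          (\<forall>m d. c (m, d) \<in> component A m d) \<and>
          finite {i. c i \<noteq> \<zero>} \<and>
          x = (\<Oplus>i\<in>{i. c i \<noteq> \<zero>}. c i)"

definition bigraded_iso :: "'a bigraded \<Rightarrow> 'b bigraded \<Rightarrow> ('a \<Rightarrow> 'b) set" where
  "bigraded_iso A B =
    {h \<in> ring_iso A B.
       (\<forall>c. \<forall>x\<in>carrier A. h (c \<odot>\<^bsub>A\<^esub> x) = c \<odot>\<^bsub>B\<^esub> h x) \<and>
       (\<forall>m d. h ` component A m d = component B m d)}"

definition bigraded_isomorphic :: "'a bigraded \<Rightarrow> 'b bigraded \<Rightarrow> bool" where
  "bigraded_isomorphic A B \<longleftrightarrow>
    bigraded_algebra A \<and> bigraded_algebra B \<and> bigraded_iso A B \<noteq> {}"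


section \<open>Lattice polytopes\<close>

definition of_int_vec :: "int ^ 'n \<Rightarrow> 'a::ring_1 ^ 'n" where
  "of_int_vec p = (\<chi> i. of_int (p $ i))"

definition lattice_polytope :: "(real ^ 'n) set \<Rightarrow> bool" where
  "lattice_polytope P \<longleftrightarrow>
    (\<exists>S :: (int ^ 'n) set. finite S \<and> S \<noteq> {} \<and> P = convex hull (of_int_vec ` S))"

definition dilate_points :: "(real ^ 'n) set \<Rightarrow> nat \<Rightarrow> (int ^ 'n) set" where
  "dilate_points P m = {p. of_int_vec p \<in> (\<lambda>x. real m *\<^sub>R x) ` P}"


section \<open>Polynomials and Laurent polynomials\<close>

text \<open>
  The product of \<^typ>\<open>'e \<Rightarrow>\<^sub>0 complex\<close> is convolution with respect to addition of exponents.
  So the two types below are \<open>\<complex>[x\<^sub>1, \<dots>, x\<^sub>n]\<close> and \<open>\<complex>[x\<^sub>1\<^sup>\<plusminus>\<^sup>1, \<dots>, x\<^sub>n\<^sup>\<plusminus>\<^sup>1]\<close>, with the variables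
  indexed by \<open>'n\<close>, and \<^typ>\<open>('e \<Rightarrow>\<^sub>0 complex) poly\<close> adjoins the variable \<open>z\<close>.
\<close>

type_synonym 'n cpoly = "(nat ^ 'n) \<Rightarrow>\<^sub>0 complex"
type_synonym 'n laurent = "(int ^ 'n) \<Rightarrow>\<^sub>0 complex"

definition scale :: "complex \<Rightarrow> ('e::comm_monoid_add \<Rightarrow>\<^sub>0 complex) poly \<Rightarrow> ('e \<Rightarrow>\<^sub>0 complex) poly"
  where "scale c F = Polynomial.smult (Poly_Mapping.single 0 c) F"


section \<open>The associated graded algebra of the semigroup algebra\<close>

definition laurent_eval :: "'n::finite laurent \<Rightarrow> complex ^ 'n \<Rightarrow> complex" where
  "laurent_eval f a =
    (\<Sum>p\<in>Poly_Mapping.keys f. Poly_Mapping.lookup f p * (\<Prod>i\<in>UNIV. (a $ i) powi (p $ i)))"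

definition laurent_partial :: "'n::finite \<Rightarrow> 'n laurent \<Rightarrow> 'n laurent" where
  "laurent_partial i f =
    (\<Sum>p\<in>Poly_Mapping.keys f.
      Poly_Mapping.single (p - axis i 1) (of_int (p $ i) * Poly_Mapping.lookup f p))"

text \<open>The infimum of the empty set is \<open>\<infinity>\<close>, so \<open>f = 0\<close> vanishes to every order.\<close>

definition vanishing_order :: "'n::finite laurent \<Rightarrow> complex ^ 'n \<Rightarrow> enat" where
  "vanishing_order f a =
    Inf {enat (length is) | is. laurent_eval (foldr laurent_partial is f) a \<noteq> 0}"

definition semigroup_algebra :: "(real ^ 'n::finite) set \<Rightarrow> 'n laurent poly set" where
  "semigroup_algebra P = {F. \<forall>m. Poly_Mapping.keys (coeff F m) \<subseteq> dilate_points P m}"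

definition filt :: "(real ^ 'n::finite) set \<Rightarrow> nat \<Rightarrow> nat \<Rightarrow> 'n laurent poly set" where
  "filt P m d =
    {monom f m | f. monom f m \<in> semigroup_algebra P \<and> enat d \<le> vanishing_order f (vec 1)}"

definition filt_quot :: "(real ^ 'n::finite) set \<Rightarrow> nat \<Rightarrow> nat \<Rightarrow> 'n laurent poly set set" where
  "filt_quot P m d = {a +o filt P m (Suc d) | a. a \<in> filt P m d}"

text \<open>
  As in the library's \<open>rcoset_mult\<close>, the union ranges over all representatives. Since
  \<open>F\<^bsub>m,d\<^esub> F\<^bsub>m',d'\<^esub> \<subseteq> F\<^bsub>m+m',d+d'\<^esub>\<close>, they all yield the same coset.
\<close>

definition coset_mult ::
  "(real ^ 'n::finite) set \<Rightarrow> nat \<times> nat \<Rightarrow> nat \<times> nat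
    \<Rightarrow> 'n laurent poly set \<Rightarrow> 'n laurent poly set \<Rightarrow> 'n laurent poly set" where
  "coset_mult P = (\<lambda>(m, d) (m', d') U V.
    \<Union>a\<in>U. \<Union>b\<in>V. (a * b) +o filt P (m + m') (Suc (d + d')))"

definition coset_scale ::
  "(real ^ 'n::finite) set \<Rightarrow> nat \<times> nat \<Rightarrow> complex
    \<Rightarrow> 'n laurent poly set \<Rightarrow> 'n laurent poly set" where
  "coset_scale P = (\<lambda>(m, d) c U. \<Union>a\<in>U. scale c a +o filt P m (Suc d))"

text \<open>
  An element of the direct sum is a family of cosets, finitely many of them nonzero. Sums of
  cosets, also in the convolution product, are the elementwise sums of \<^theory>\<open>HOL-Library.Set_Algebras\<close>;
  the convolution sum is never empty.
\<close>

definition gr_carrier ::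
  "(real ^ 'n::finite) set \<Rightarrow> (nat \<times> nat \<Rightarrow> 'n laurent poly set) set" where
  "gr_carrier P =
    {u. (\<forall>m d. u (m, d) \<in> filt_quot P m d) \<and>
        finite {(m, d). u (m, d) \<noteq> filt P m (Suc d)}}"

definition gr_algebra ::
  "(real ^ 'n::finite) set \<Rightarrow> (nat \<times> nat \<Rightarrow> 'n laurent poly set) bigraded" where
  "gr_algebra P =
    \<lparr>carrier = gr_carrier P,
     monoid.mult = (\<lambda>u v (m, d).
       \<Sum>(i, j)\<in>{..m} \<times> {..d}. coset_mult P (i, j) (m - i, d - j) (u (i, j)) (v (m - i, d - j))),
     one = (\<lambda>(m, d). (if (m, d) = (0, 0) then 1 else 0) +o filt P m (Suc d)),
     ring.zero = (\<lambda>(m, d). filt P m (Suc d)),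
     add = (\<lambda>u v i. u i + v i),
     module.smult = (\<lambda>c u i. coset_scale P i c (u i)),
     component = (\<lambda>m d. {u \<in> gr_carrier P.
       \<forall>m' d'. (m', d') \<noteq> (m, d) \<longrightarrow> u (m', d') = filt P m' (Suc d')})\<rparr>"


section \<open>The harmonic algebra\<close>

definition cpoly_eval :: "'n::finite cpoly \<Rightarrow> complex ^ 'n \<Rightarrow> complex" where
  "cpoly_eval f z =
    (\<Sum>a\<in>Poly_Mapping.keys f. Poly_Mapping.lookup f a * (\<Prod>i\<in>UNIV. (z $ i) ^ (a $ i)))"

definition tdeg :: "nat ^ 'n::finite \<Rightarrow> nat" where
  "tdeg a = (\<Sum>i\<in>UNIV. a $ i)"

definition homogeneous :: "nat \<Rightarrow> 'n::finite cpoly \<Rightarrow> bool" where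
  "homogeneous d f \<longleftrightarrow> (\<forall>a\<in>Poly_Mapping.keys f. tdeg a = d)"

definition homogeneous_part :: "nat \<Rightarrow> 'n::finite cpoly \<Rightarrow> 'n cpoly" where
  "homogeneous_part d f =
    (\<Sum>a\<in>{a \<in> Poly_Mapping.keys f. tdeg a = d}. Poly_Mapping.single a (Poly_Mapping.lookup f a))"

text \<open>Only meaningful for \<open>f \<noteq> 0\<close>.\<close>

definition top_part :: "'n::finite cpoly \<Rightarrow> 'n cpoly" where
  "top_part f = homogeneous_part (Max (tdeg ` Poly_Mapping.keys f)) f"

definition vanishing_ideal :: "(complex ^ 'n::finite) set \<Rightarrow> 'n cpoly set" where
  "vanishing_ideal Z = {f. \<forall>z\<in>Z. cpoly_eval f z = 0}"

definition gr_ideal :: "(complex ^ 'n::finite) set \<Rightarrow> 'n cpoly set" where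
  "gr_ideal Z = Idl\<^bsub>univ_ring\<^esub> {top_part f | f. f \<in> vanishing_ideal Z \<and> f \<noteq> 0}"

text \<open>
  If \<open>a $ i = 0\<close> then the truncated subtraction below is harmless, as the coefficient is \<open>0\<close>.
\<close>

definition partial :: "'n::finite \<Rightarrow> 'n cpoly \<Rightarrow> 'n cpoly" where
  "partial i g =
    (\<Sum>a\<in>Poly_Mapping.keys g.
      Poly_Mapping.single (a - axis i 1) (of_nat (a $ i) * Poly_Mapping.lookup g a))"

text \<open>
  The composite of \<open>(\<partial>/\<partial>x\<^sub>i)^(a $ i)\<close> over all \<open>i\<close>. The fold does not depend on the order
  of the variables by \<open>comp_fun_commute_partial\<close>.
\<close>

definition monomial_diff :: "nat ^ 'n::finite \<Rightarrow> 'n cpoly \<Rightarrow> 'n cpoly" where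
  "monomial_diff a g = Finite_Set.fold (\<lambda>i. partial i ^^ (a $ i)) g UNIV"

definition diff_op :: "'n::finite cpoly \<Rightarrow> 'n cpoly \<Rightarrow> 'n cpoly" where
  "diff_op f g =
    (\<Sum>a\<in>Poly_Mapping.keys f. Poly_Mapping.single 0 (Poly_Mapping.lookup f a) * monomial_diff a g)"

definition harmonic_space :: "(complex ^ 'n::finite) set \<Rightarrow> 'n cpoly set" where
  "harmonic_space Z = {g. \<forall>f\<in>gr_ideal Z. diff_op f g = 0}"

abbreviation dilate_harmonics :: "(real ^ 'n::finite) set \<Rightarrow> nat \<Rightarrow> 'n cpoly set" where
  "dilate_harmonics P m \<equiv> harmonic_space (of_int_vec ` dilate_points P m)"

definition harmonic_algebra :: "(real ^ 'n::finite) set \<Rightarrow> 'n cpoly poly bigraded" where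
  "harmonic_algebra P =
    \<lparr>carrier = {F. \<forall>m. coeff F m \<in> dilate_harmonics P m},
     monoid.mult = (*),
     one = 1,
     ring.zero = 0,
     add = (+),
     module.smult = scale,
     component = (\<lambda>m d. {monom g m | g. g \<in> dilate_harmonics P m \<and> homogeneous d g})\<rparr>"

lemma lookup_partial:
  "Poly_Mapping.lookup (partial i g) b =
    of_nat (b $ i + 1) * Poly_Mapping.lookup g (b + axis i 1)"
proof -
  have "Poly_Mapping.lookup (partial i g) b =
      (\<Sum>a\<in>Poly_Mapping.keys g. if a = b + axis i 1
         then of_nat (a $ i) * Poly_Mapping.lookup g a else 0)"
    unfolding partial_def lookup_sum
  proof (rule sum.cong[OF refl])
    fix a assume "a \<in> Poly_Mapping.keys g"
    have "a - axis i 1 = b \<longleftrightarrow> a = b + axis i 1" if "a $ i \<noteq> 0"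
      using that by (auto simp: vec_eq_iff axis_def split: if_splits)
    moreover have "a \<noteq> b + axis i 1" if "a $ i = 0"
      using that by (auto simp: vec_eq_iff axis_def)
    ultimately show "Poly_Mapping.lookup
        (Poly_Mapping.single (a - axis i 1) (of_nat (a $ i) * Poly_Mapping.lookup g a)) b =
        (if a = b + axis i 1 then of_nat (a $ i) * Poly_Mapping.lookup g a else 0)"
      by (cases "a $ i = 0") (auto simp: lookup_single when_def)
  qed
  also have "\<dots> = of_nat (b $ i + 1) * Poly_Mapping.lookup g (b + axis i 1)"
    by (auto simp: sum.delta in_keys_iff axis_def)
  finally show ?thesis .
qed

lemma partial_commute: "partial i (partial j g) = partial j (partial i g)"
  by (rule poly_mapping_eqI)
    (cases "i = j", auto simp: lookup_partial axis_def algebra_simps)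

lemma comp_fun_commute_partial:
  fixes a :: "nat ^ 'n::finite"
  shows "comp_fun_commute (\<lambda>i. partial i ^^ (a $ i))"
proof
  fix i j :: 'n
  have "partial i ((partial j ^^ l) g) = (partial j ^^ l) (partial i g)" for l g
    by (induction l) (simp_all, metis partial_commute)
  hence "(partial i ^^ k) ((partial j ^^ l) g) = (partial j ^^ l) ((partial i ^^ k) g)" for k l g
    by (induction k) auto
  thus "(partial j ^^ (a $ j)) \<circ> (partial i ^^ (a $ i)) =
      (partial i ^^ (a $ i)) \<circ> (partial j ^^ (a $ j))"
    by auto
qed

end

theory Submission
  imports Defs
begin

text \<open>
  Substitute \<open>x = e\<^sup>y\<close>: a Laurent polynomial \<open>f = \<Sum> c\<^sub>p x\<^sup>p\<close> becomes the exponential sum \<open>\<Sum> c\<^sub>p e\<^sup>L\<close> with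
  \<open>L = p\<^sub>1 y\<^sub>1 + \<dots> + p\<^sub>n y\<^sub>n\<close>, whose order of vanishing at \<open>0\<close> is that of \<open>f\<close> at \<open>e\<close>. Sending \<open>f\<close> to its lowest
  homogeneous part in \<open>y\<close> is injective on \<open>F\<^bsub>m,d\<^esub>/F\<^bsub>m,d+1\<^esub>\<close> and multiplicative. Pairing a polynomial \<open>q\<close>, as a
  differential operator at \<open>y = 0\<close>, with the exponential sum gives \<open>\<Sum> c\<^sub>p q(p)\<close>. Hence lowest parts are annihilated
  by the top parts of polynomials vanishing on the exponents, and conversely, by the Fredholm alternative, every
  homogeneous harmonic polynomial is such a lowest part.
\<close>


subsection \<open>Finitely supported functions\<close>

text \<open>The variables \<open>y\<close> are chosen because
  \<open>\<partial>/\<partial>y\<^sub>i\<close> multiplies the image of \<open>x\<^sup>p\<close> by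
  the number \<open>p $ i\<close>. A constant-coefficient operator \<open>q\<close> therefore has
  eigenvalue \<open>q(p)\<close> there, whereas repeated derivatives in \<open>x\<close> would
  produce falling factorials. No power series is ever formed: \<open>exp_part d\<close> records one
  degree at a time as a polynomial. Two obstacles shape the proof. That harmonic spaces of dilates
  multiply into each other is not visible from their definition; it is obtained by lifting harmonic
  polynomials to Laurent polynomials, multiplying there, and taking lowest parts. Conversely, the
  algebra axioms are awkward to verify for families of cosets; they are transported from the
  harmonic side. For this reason the isomorphism runs from harmonic polynomials to cosets, each
  coset being described by its leading form.\<close>

abbreviation "lookup \<equiv> Poly_Mapping.lookup"
abbreviation "keys \<equiv> Poly_Mapping.keys"
abbreviation "const c \<equiv> Poly_Mapping.single 0 c"

lemma lookup_const_mult [simp]: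
  fixes f :: "'a::monoid_add \<Rightarrow>\<^sub>0 'b::semiring_0"
  shows "lookup (const c * f) a = c * lookup f a"
  unfolding mult_map_scale_conv_mult[symmetric] by (simp add: Poly_Mapping.map.rep_eq when_def)

text \<open>Reduces additive and biadditive identities, such as the product formulas below, to
  single monomials.\<close>

lemma poly_mapping_single_induct [case_names zero single add]:
  assumes "P 0" "\<And>a c. P (Poly_Mapping.single a c)" "\<And>f g. P f \<Longrightarrow> P g \<Longrightarrow> P (f + g)"
  shows "P f"
proof (induction f rule: update_induct)
  case (update f a b)
  have "Poly_Mapping.update a b f = f + Poly_Mapping.single a b"
    using update(1)
    by (intro poly_mapping_eqI) (auto simp: lookup_update lookup_add lookup_single in_keys_iff when_def)
  thus ?case using assms update by auto
qed (use assms in simp)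

text \<open>Cancellation can shrink the support of a sum. Summing over a common finite superset of
  all supports involved makes additivity termwise.\<close>

lemma sum_keys_superset:
  assumes "finite S" "keys f \<subseteq> S" "\<And>a. \<phi> a 0 = 0"
  shows "(\<Sum>a\<in>keys f. \<phi> a (lookup f a)) = (\<Sum>a\<in>S. \<phi> a (lookup f a))"
  using assms by (intro sum.mono_neutral_left) (auto simp: in_keys_iff)

lemma lookup_single_mult_add [simp]:
  fixes g :: "'a::cancel_comm_monoid_add \<Rightarrow>\<^sub>0 'b::semiring_0"
  shows "lookup (Poly_Mapping.single e c * g) (e + a) = c * lookup g a"
  by (induction g rule: poly_mapping_single_induct)
     (auto simp: mult_single lookup_single lookup_add algebra_simps when_def)

lemma lookup_single_mult_eq_0:
  fixes g :: "'a::comm_monoid_add \<Rightarrow>\<^sub>0 'b::semiring_0"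
  assumes "\<And>b. a \<noteq> e + b"
  shows "lookup (Poly_Mapping.single e c * g) a = 0"
  using assms by (induction g rule: poly_mapping_single_induct)
     (auto simp: mult_single lookup_single lookup_add algebra_simps when_def)

subsection \<open>Exponential expansion of Laurent polynomials\<close>

definition linear_form :: "int ^ 'n::finite \<Rightarrow> 'n cpoly" where
  "linear_form p = (\<Sum>i\<in>UNIV. Poly_Mapping.single (axis i 1) (of_int (p $ i)))"

text \<open>The coefficient of \<open>y^a\<close> in \<open>e^L\<close>, that is
  \<open>p^a / a!\<close> in multi-index notation, with \<open>0^0 = 1\<close>.\<close>

definition exp_coeff :: "int ^ 'n::finite \<Rightarrow> nat ^ 'n \<Rightarrow> complex" where
  "exp_coeff p a = (\<Prod>i\<in>UNIV. of_int (p $ i) ^ (a $ i) / fact (a $ i))"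

text \<open>
  The degree \<open>d\<close> part of the power series \<open>f(e\<^sup>y)\<close>: the monomial \<open>x\<^sup>p\<close> becomes \<open>e\<^sup>L\<close> for the linear form
  \<open>L = p\<^sub>1 y\<^sub>1 + \<dots> + p\<^sub>n y\<^sub>n\<close>.
\<close>

definition exp_part :: "nat \<Rightarrow> 'n::finite laurent \<Rightarrow> 'n cpoly" where
  "exp_part d f = (\<Sum>p\<in>keys f. const (lookup f p / fact d) * linear_form p ^ d)"

lemma linear_form_add: "linear_form (p + q) = linear_form p + linear_form q"
  by (simp add: linear_form_def sum.distrib single_add)

text \<open>The coefficientwise form of
  \<open>\<partial>/\<partial>y\<^sub>i e^L = p\<^sub>i e^L\<close>.\<close>

lemma exp_coeff_add_axis:
  "of_nat (a $ i + 1) * exp_coeff p (a + axis i 1) = of_int (p $ i) * exp_coeff p a"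
proof -
  have "exp_coeff p (a + axis i 1) =
     of_int (p $ i) ^ (a $ i + 1) / fact (a $ i + 1) * (\<Prod>j\<in>UNIV - {i}. of_int (p $ j) ^ (a $ j) / fact (a $ j))"
    unfolding exp_coeff_def by (subst prod.remove[of _ i]) (auto simp: axis_def intro!: prod.cong)
  moreover have "exp_coeff p a = of_int (p $ i) ^ (a $ i) / fact (a $ i) *
     (\<Prod>j\<in>UNIV - {i}. of_int (p $ j) ^ (a $ j) / fact (a $ j))"
    unfolding exp_coeff_def by (subst prod.remove[of _ i]) auto
  moreover have "of_nat (k + 1) * (x ^ (k + 1) / fact (k + 1)) = x * (x ^ k / fact k)" for k and x :: complex
    by (simp add: fact_Suc divide_simps del: of_nat_Suc of_nat_add)
  ultimately show ?thesis
    by (simp only: mult.assoc[symmetric])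
qed

lemma tdeg_add: "tdeg (a + b) = tdeg a + tdeg b"
  by (simp add: tdeg_def sum.distrib)

lemma tdeg_axis [simp]: "tdeg (axis i k) = k"
  by (simp add: tdeg_def axis_def)

lemma tdeg_0 [simp]: "tdeg 0 = 0"
  by (simp add: tdeg_def)

lemma tdeg_eq_0_iff [simp]: "tdeg a = 0 \<longleftrightarrow> a = 0"
  by (auto simp: tdeg_def vec_eq_iff)

text \<open>Either \<open>x\<^sub>i\<close> does not divide the monomial with exponent
  \<open>a\<close>, or one factor \<open>x\<^sub>i\<close> splits off; truncated subtraction stays
  out of later arguments.\<close>

lemma vec_nat_axis_cases:
  fixes a :: "nat ^ 'n::finite"
  obtains "a $ i = 0" | b where "a = b + axis i 1" "a $ i = b $ i + 1"
proof (cases "a $ i = 0")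
  case False
  have "a = (a - axis i 1) + axis i 1" "a $ i = (a - axis i 1) $ i + 1"
    using False by (auto simp: vec_eq_iff axis_def)
  thus ?thesis using that by blast
qed (use that in blast)

text \<open>The multinomial theorem. Multiplying by one more factor \<open>L\<close>, the variable
  with index \<open>i\<close> contributes \<open>d! * a\<^sub>i * p^a / a!\<close>, and the
  \<open>a\<^sub>i\<close> add up to \<open>d + 1\<close>.\<close>

lemma lookup_linear_form_power:
  fixes p :: "int ^ 'n::finite"
  shows "lookup (linear_form p ^ d) a = (if tdeg a = d then fact d * exp_coeff p a else 0)"
proof (induction d arbitrary: a)
  case 0
  show ?case by (auto simp: lookup_one when_def exp_coeff_def)
next
  case (Suc d)
  have *: "lookup (Poly_Mapping.single (axis i 1) (of_int (p $ i)) * linear_form p ^ d) a =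
      (if tdeg a = Suc d then fact d * of_nat (a $ i) * exp_coeff p a else 0)" for i
  proof (cases a i rule: vec_nat_axis_cases)
    case 1
    have "a \<noteq> axis i 1 + b" for b
      using 1 by (auto simp: axis_def vec_eq_iff)
    thus ?thesis using 1 by (auto simp: lookup_single_mult_eq_0)
  next
    case (2 b)
    have "lookup (Poly_Mapping.single (axis i 1) (of_int (p $ i)) * linear_form p ^ d) a =
      of_int (p $ i) * lookup (linear_form p ^ d) b"
      unfolding 2(1) by (subst add.commute) simp
    moreover have "of_nat (a $ i) * exp_coeff p a = of_int (p $ i) * exp_coeff p b"
      using exp_coeff_add_axis[of b i p] 2 by simp
    ultimately show ?thesis using 2 Suc
      by (auto simp: tdeg_add)
  qed
  have linear_form_mult: "linear_form p * g = (\<Sum>i\<in>UNIV. Poly_Mapping.single (axis i 1) (of_int (p $ i)) * g)" for g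
    by (simp add: linear_form_def sum_distrib_right)
  have "lookup (linear_form p ^ Suc d) a = (\<Sum>i\<in>UNIV. if tdeg a = Suc d then fact d * of_nat (a $ i) * exp_coeff p a else 0)"
    unfolding power_Suc linear_form_mult lookup_sum * ..
  also have "\<dots> = (if tdeg a = Suc d then fact d * of_nat (tdeg a) * exp_coeff p a else 0)"
  proof -
    have "(\<Sum>i\<in>UNIV. fact d * of_nat (a $ i) * exp_coeff p a) = fact d * of_nat (tdeg a) * exp_coeff p a"
      by (simp add: tdeg_def sum_distrib_left sum_distrib_right)
    thus ?thesis by (cases "tdeg a = Suc d") simp_all
  qed
  finally show ?case by (auto simp: algebra_simps)
qed

lemma exp_part_superset:
  assumes "finite S" "keys f \<subseteq> S"
  shows "exp_part d f = (\<Sum>p\<in>S. const (lookup f p / fact d) * linear_form p ^ d)"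
  unfolding exp_part_def using assms by (intro sum_keys_superset) auto

lemma lookup_exp_part_superset:
  assumes "finite S" "keys f \<subseteq> S"
  shows "lookup (exp_part d f) a = (if tdeg a = d then \<Sum>p\<in>S. lookup f p * exp_coeff p a else 0)"
  by (auto simp: exp_part_superset[OF assms] lookup_sum lookup_linear_form_power)

lemma lookup_exp_part:
  "lookup (exp_part d f) a = (if tdeg a = d then \<Sum>p\<in>keys f. lookup f p * exp_coeff p a else 0)"
  by (intro lookup_exp_part_superset) auto

lemma exp_part_0 [simp]: "exp_part d 0 = 0"
  by (simp add: exp_part_def)

lemma exp_part_single: "exp_part d (Poly_Mapping.single p c) = const (c / fact d) * linear_form p ^ d"
  by (subst exp_part_superset[where S = "{p}"]) auto

lemma exp_part_add: "exp_part d (f + g) = exp_part d f + exp_part d g"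
proof -
  have S: "finite (keys f \<union> keys g)" "keys f \<subseteq> keys f \<union> keys g"
    "keys g \<subseteq> keys f \<union> keys g" "keys (f + g) \<subseteq> keys f \<union> keys g"
    using Poly_Mapping.keys_add[of f g] by auto
  show ?thesis
    unfolding exp_part_superset[OF S(1,2)] exp_part_superset[OF S(1,3)] exp_part_superset[OF S(1,4)]
    by (simp add: lookup_add add_divide_distrib single_add algebra_simps sum.distrib)
qed

lemma exp_part_const_mult: "exp_part d (const c * f) = const c * exp_part d f"
proof -
  have S: "finite (keys f)" "keys (const c * f) \<subseteq> keys f"
    by (auto simp: in_keys_iff)
  have *: "const (c * u) = const c * const u" for u :: complex
    by (simp add: mult_single)
  show ?thesis
    unfolding exp_part_superset[OF S] exp_part_def[of d f]
    by (simp add: sum_distrib_left mult.assoc * flip: times_divide_eq_right)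
qed

lemma exp_part_uminus: "exp_part d (- f) = - exp_part d f"
  using exp_part_add[of d f "- f"] by (simp add: add_eq_0_iff2 add.commute)

lemma exp_part_diff: "exp_part d (f - g) = exp_part d f - exp_part d g"
  using exp_part_add[of d f "- g"] by (simp add: exp_part_uminus)

text \<open>The Cauchy product of \<open>f(e^y)\<close> and \<open>g(e^y)\<close>. For monomials it
  is the binomial theorem applied to the sum of two linear forms, and both sides are
  biadditive.\<close>

lemma exp_part_mult:
  "exp_part d (f * g) = (\<Sum>j\<le>d. exp_part j f * exp_part (d - j) g)"
proof (induction f rule: poly_mapping_single_induct)
  case (single p c)
  show ?case
  proof (induction g rule: poly_mapping_single_induct)
    case (single q c')
    have "const (c * c' / fact d) * (linear_form p + linear_form q) ^ d =
      (\<Sum>j\<le>d. const (c * c' / fact d) * (of_nat (d choose j) * linear_form p ^ j * linear_form q ^ (d - j)))"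
      by (simp add: binomial_ring sum_distrib_left)
    also have "\<dots> = (\<Sum>j\<le>d. (const (c / fact j) * linear_form p ^ j) * (const (c' / fact (d - j)) * linear_form q ^ (d - j)))"
    proof (rule sum.cong[OF refl])
      fix j assume "j \<in> {..d}"
      hence "c * c' / fact d * of_nat (d choose j) = c / fact j * (c' / fact (d - j))"
        by (auto simp: binomial_fact)
      hence "const (c * c' / fact d) * of_nat (d choose j) = (const (c / fact j) * const (c' / fact (d - j)) :: 'a cpoly)"
        by (simp only: mult_single add_0 flip: single_of_nat)
      thus "const (c * c' / fact d) * (of_nat (d choose j) * linear_form p ^ j * linear_form q ^ (d - j)) =
        (const (c / fact j) * linear_form p ^ j) * (const (c' / fact (d - j)) * linear_form q ^ (d - j))"
        by (simp only: mult.assoc[symmetric]) (simp only: ac_simps)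
    qed
    finally show ?case by (simp add: mult_single exp_part_single linear_form_add)
  qed (auto simp: exp_part_add algebra_simps sum.distrib)
qed (auto simp: exp_part_add algebra_simps sum.distrib)

text \<open>In the Cauchy product every term other than \<open>j = d\<close> has a factor below the
  lowest degree of \<open>f\<close> or of \<open>g\<close>. This makes passage to lowest parts
  multiplicative.\<close>

lemma exp_part_mult_vanishing:
  assumes "\<And>j. j < d \<Longrightarrow> exp_part j f = 0" "\<And>j. j < d' \<Longrightarrow> exp_part j g = 0"
  shows "exp_part (d + d') (f * g) = exp_part d f * exp_part d' g"
    and "\<And>j. j < d + d' \<Longrightarrow> exp_part j (f * g) = 0"
proof -
  have "exp_part j f * exp_part (d + d' - j) g = 0" if "j \<noteq> d" "j \<le> d + d'" for j
    using assms(1)[of j] assms(2)[of "d + d' - j"] that by (cases "j < d") auto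
  hence "(\<Sum>j\<le>d + d'. exp_part j f * exp_part (d + d' - j) g) = (\<Sum>j\<in>{d}. exp_part j f * exp_part (d + d' - j) g)"
    by (intro sum.mono_neutral_right) auto
  thus "exp_part (d + d') (f * g) = exp_part d f * exp_part d' g"
    by (simp add: exp_part_mult)
next
  fix j assume j: "j < d + d'"
  have "exp_part k f * exp_part (j - k) g = 0" if "k \<le> j" for k
    using assms(1)[of k] assms(2)[of "j - k"] that j by (cases "k < d") auto
  thus "exp_part j (f * g) = 0" by (simp add: exp_part_mult)
qed

subsection \<open>Harmonic spaces\<close>

lemma lookup_partial_power:
  fixes b :: "nat ^ 'n::finite"
  shows "lookup ((partial i ^^ k) g) b = fact (b $ i + k) / fact (b $ i) * lookup g (b + axis i k)"
proof (induction k arbitrary: g)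
  case (Suc k)
  have "axis i (Suc k) = axis i k + axis i 1"
    by (auto simp: axis_def vec_eq_iff)
  thus ?case
    by (simp add: Suc funpow_Suc_right lookup_partial axis_def[of i k] add_ac del: funpow.simps of_nat_Suc)
next
  case 0
  have *: "axis i 0 = (0 :: nat ^ 'n)" by (simp add: axis_def vec_eq_iff)
  show ?case by (subst *) simp
qed

text \<open>At \<open>b = 0\<close> the weight is \<open>a!\<close>, which cancels the denominator
  of \<open>exp_coeff\<close>; pairing an operator with an exponential sum thus becomes evaluation
  at the exponents.\<close>

lemma lookup_monomial_diff:
  fixes a b :: "nat ^ 'n::finite"
  shows "lookup (monomial_diff a g) b = (\<Prod>i\<in>UNIV. fact (a $ i + b $ i) / fact (b $ i)) * lookup g (a + b)"
proof -
  interpret comp_fun_commute "\<lambda>i. partial i ^^ (a $ i)"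
    by (rule comp_fun_commute_partial)
  \<comment> \<open>Generalised from \<open>UNIV\<close> to any set \<open>S\<close> of variables
    for induction; the sum of axis vectors is \<open>a\<close> restricted to
    \<open>S\<close>.\<close>
  have "lookup (Finite_Set.fold (\<lambda>i. partial i ^^ (a $ i)) g S) b =
    (\<Prod>i\<in>S. fact (a $ i + b $ i) / fact (b $ i)) * lookup g ((\<Sum>i\<in>S. axis i (a $ i)) + b)" for S b
  proof (induction S arbitrary: b rule: infinite_finite_induct)
    case (insert i S)
    have "(\<Prod>j\<in>S. fact (a $ j + (b + axis i (a $ i)) $ j) / fact ((b + axis i (a $ i)) $ j)) =
       (\<Prod>j\<in>S. fact (a $ j + b $ j) / fact (b $ j) :: complex)"
      using insert by (intro prod.cong) (auto simp: axis_def)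
    thus ?case using insert
      by (simp add: lookup_partial_power algebra_simps)
  qed auto
  moreover have "(\<Sum>i\<in>UNIV. axis i (a $ i)) = a"
    by (auto simp: vec_eq_iff axis_def)
  ultimately show ?thesis by (simp add: monomial_diff_def)
qed

lemma lookup_diff_op_superset:
  assumes "finite S" "keys q \<subseteq> S"
  shows "lookup (diff_op q g) b =
    (\<Sum>a\<in>S. lookup q a * ((\<Prod>i\<in>UNIV. fact (a $ i + b $ i) / fact (b $ i)) * lookup g (a + b)))"
proof -
  have "lookup (diff_op q g) b = (\<Sum>a\<in>keys q. lookup q a * lookup (monomial_diff a g) b)"
    by (simp add: diff_op_def lookup_sum)
  also have "\<dots> = (\<Sum>a\<in>S. lookup q a * lookup (monomial_diff a g) b)"
    using assms by (intro sum_keys_superset) auto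
  finally show ?thesis by (simp add: lookup_monomial_diff)
qed

lemmas lookup_diff_op = lookup_diff_op_superset[OF finite_keys subset_refl]

lemma diff_op_single: "diff_op (Poly_Mapping.single a c) g = const c * monomial_diff a g"
  by (simp add: diff_op_def)

lemma diff_op_add_left: "diff_op (q + r) g = diff_op q g + diff_op r g"
proof (rule poly_mapping_eqI)
  have S: "finite (keys q \<union> keys r)" "keys q \<subseteq> keys q \<union> keys r"
    "keys r \<subseteq> keys q \<union> keys r" "keys (q + r) \<subseteq> keys q \<union> keys r"
    using Poly_Mapping.keys_add[of q r] by auto
  show "lookup (diff_op (q + r) g) b = lookup (diff_op q g + diff_op r g) b" for b
    unfolding lookup_add lookup_diff_op_superset[OF S(1,2)] lookup_diff_op_superset[OF S(1,3)]
      lookup_diff_op_superset[OF S(1,4)]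
    by (simp add: sum.distrib algebra_simps)
qed

lemma diff_op_add_right: "diff_op q (g + h) = diff_op q g + diff_op q h"
  by (rule poly_mapping_eqI) (simp add: lookup_add lookup_diff_op sum.distrib algebra_simps)

lemma diff_op_const_mult: "diff_op q (const c * g) = const c * diff_op q g"
  by (rule poly_mapping_eqI) (simp add: lookup_diff_op sum_distrib_left mult.left_commute)

lemma diff_op_0_left [simp]: "diff_op 0 g = 0"
  by (simp add: diff_op_def)

lemma diff_op_0_right [simp]: "diff_op q 0 = 0"
  by (rule poly_mapping_eqI) (simp add: lookup_diff_op)

lemma monomial_diff_add: "monomial_diff (a + b) g = monomial_diff a (monomial_diff b g)"
proof (rule poly_mapping_eqI)
  fix c
  have "(\<Prod>i\<in>UNIV. fact (a $ i + b $ i + c $ i) / fact (c $ i)) =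
    (\<Prod>i\<in>UNIV. fact (a $ i + c $ i) / fact (c $ i)) *
    (\<Prod>i\<in>UNIV. fact (b $ i + (a $ i + c $ i)) / fact (a $ i + c $ i) :: complex)"
    by (simp add: add_ac flip: prod.distrib)
  thus "lookup (monomial_diff (a + b) g) c = lookup (monomial_diff a (monomial_diff b g)) c"
    by (simp add: lookup_monomial_diff add_ac)
qed

lemma monomial_diff_const_mult: "monomial_diff a (const c * g) = const c * monomial_diff a g"
  by (rule poly_mapping_eqI) (simp add: lookup_monomial_diff)

text \<open>Polynomials act on polynomials as a ring of operators, so the annihilator of a fixed
  \<open>g\<close> is an ideal.\<close>

lemma diff_op_mult: "diff_op (q * r) g = diff_op q (diff_op r g)"
proof (induction q rule: poly_mapping_single_induct)
  case (single a c)
  show ?case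
  proof (induction r rule: poly_mapping_single_induct)
    case (single b c')
    show ?case
      by (simp add: mult_single diff_op_single monomial_diff_add monomial_diff_const_mult
            flip: mult.assoc)
  qed (auto simp: algebra_simps diff_op_add_left diff_op_add_right)
qed (auto simp: algebra_simps diff_op_add_left)

section \<open>Homogeneous parts and the grading of harmonic spaces\<close>

lemma lookup_homogeneous_part:
  "lookup (homogeneous_part d f) a = (if tdeg a = d then lookup f a else 0)"
proof -
  have "lookup (homogeneous_part d f) a = (\<Sum>b\<in>{b \<in> keys f. tdeg b = d}. if b = a then lookup f a else 0)"
    by (auto simp: homogeneous_part_def lookup_sum lookup_single when_def intro!: sum.cong)
  thus ?thesis by (auto simp: in_keys_iff)
qed

lemma homogeneous_iff: "homogeneous d f \<longleftrightarrow> (\<forall>a. tdeg a \<noteq> d \<longrightarrow> lookup f a = 0)"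
  by (auto simp: homogeneous_def in_keys_iff)

lemma homogeneous_exp_part: "homogeneous d (exp_part d f)"
  by (auto simp: homogeneous_iff lookup_exp_part)

lemma cring_univ_ring: "cring (univ_ring :: 'a::comm_ring_1 ring)"
  by unfold_locales
    (auto simp: univ_ring_def algebra_simps Units_def, metis add.commute neg_eq_iff_add_eq_0)

text \<open>The operators annihilating \<open>g\<close> form an ideal, so it contains
  \<open>gr_ideal Z\<close> as soon as it contains the generating top parts.\<close>

lemma harmonic_space_iff:
  fixes g :: "'n::finite cpoly"
  shows "g \<in> harmonic_space Z \<longleftrightarrow> (\<forall>f\<in>vanishing_ideal Z. f \<noteq> 0 \<longrightarrow> diff_op (top_part f) g = 0)"
proof
  let ?S = "{top_part f |f. f \<in> vanishing_ideal Z \<and> f \<noteq> 0}"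
  interpret cring "univ_ring :: 'n cpoly ring" by (rule cring_univ_ring)
  show "\<forall>f\<in>vanishing_ideal Z. f \<noteq> 0 \<longrightarrow> diff_op (top_part f) g = 0" if "g \<in> harmonic_space Z"
  proof -
    have "?S \<subseteq> gr_ideal Z"
      unfolding gr_ideal_def by (rule genideal_self) (simp add: univ_ring_def)
    thus ?thesis using that by (auto simp: harmonic_space_def)
  qed
  assume *: "\<forall>f\<in>vanishing_ideal Z. f \<noteq> 0 \<longrightarrow> diff_op (top_part f) g = 0"
  have "ideal {q. diff_op q g = 0} (univ_ring :: 'n cpoly ring)"
  proof (rule idealI)
    show "subgroup {q. diff_op q g = 0} (add_monoid (univ_ring :: 'n cpoly ring))"
    proof (rule add.subgroupI)
      fix q assume q: "q \<in> {q. diff_op q g = 0}"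
      have "\<ominus>\<^bsub>univ_ring\<^esub> q = - q"
        by (rule minus_equality) (auto simp: univ_ring_def)
      moreover have "diff_op (- q) g = 0"
        using diff_op_add_left[of q "-q" g] q by simp
      ultimately show "\<ominus>\<^bsub>univ_ring\<^esub> q \<in> {q. diff_op q g = 0}" by simp
    qed (auto simp: univ_ring_def diff_op_add_left intro!: exI[of _ 0])
  next
    fix q r assume "q \<in> {q. diff_op q g = 0}"
    hence "diff_op (r * q) g = 0" by (simp add: diff_op_mult)
    thus "r \<otimes>\<^bsub>univ_ring\<^esub> q \<in> {q. diff_op q g = 0}" "q \<otimes>\<^bsub>univ_ring\<^esub> r \<in> {q. diff_op q g = 0}"
      by (simp_all add: univ_ring_def mult.commute)
  qed (rule ring_axioms)
  hence "gr_ideal Z \<subseteq> {q. diff_op q g = 0}"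
    unfolding gr_ideal_def using * by (intro genideal_minimal) auto
  thus "g \<in> harmonic_space Z" by (auto simp: harmonic_space_def)
qed

lemma top_part_eq:
  fixes f :: "'n::finite cpoly"
  assumes "f \<noteq> 0"
  obtains e where "top_part f = homogeneous_part e f" "\<And>a. e < tdeg a \<Longrightarrow> lookup f a = 0"
    "\<exists>a. tdeg a = e \<and> lookup f a \<noteq> 0"
proof (rule that[of "Max (tdeg ` keys f)"])
  have ne: "keys f \<noteq> {}"
    using assms by (metis finite_keys poly_mapping_eqI lookup_zero in_keys_iff empty_iff)
  show "lookup f a = 0" if "Max (tdeg ` keys f) < tdeg a" for a
  proof (rule ccontr)
    assume "lookup f a \<noteq> 0"
    hence "tdeg a \<le> Max (tdeg ` keys f)" by (intro Max_ge) (auto simp: in_keys_iff)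
    thus False using that by simp
  qed
  have "Max (tdeg ` keys f) \<in> tdeg ` keys f" using ne by (intro Max_in) auto
  thus "\<exists>a. tdeg a = Max (tdeg ` keys f) \<and> lookup f a \<noteq> 0" by (auto simp: in_keys_iff)
next
  show "top_part f = homogeneous_part (Max (tdeg ` keys f)) f" by (simp add: top_part_def)
qed

text \<open>An operator homogeneous of degree \<open>e\<close> lowers degrees by exactly
  \<open>e\<close>. As top parts are homogeneous, this is what makes harmonic spaces graded.\<close>

lemma diff_op_homogeneous:
  assumes "homogeneous e q"
  shows "diff_op q (homogeneous_part d g) =
    (if e \<le> d then homogeneous_part (d - e) (diff_op q g) else 0)"
proof (rule poly_mapping_eqI)
  fix b
  have "tdeg (a + b) = d \<longleftrightarrow> e \<le> d \<and> tdeg b = d - e" if "a \<in> keys q" for a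
    using assms that by (auto simp: homogeneous_def tdeg_add)
  thus "lookup (diff_op q (homogeneous_part d g)) b =
    lookup (if e \<le> d then homogeneous_part (d - e) (diff_op q g) else 0) b"
    by (auto simp: lookup_diff_op lookup_homogeneous_part)
qed

lemma homogeneous_homogeneous_part [simp]: "homogeneous d (homogeneous_part d f)"
  by (simp add: homogeneous_iff lookup_homogeneous_part)

lemma homogeneous_part_0 [simp]: "homogeneous_part d 0 = 0"
  by (rule poly_mapping_eqI) (simp add: lookup_homogeneous_part)

lemma homogeneous_part_add: "homogeneous_part d (f + g) = homogeneous_part d f + homogeneous_part d g"
  by (rule poly_mapping_eqI) (simp add: lookup_homogeneous_part lookup_add)

lemma homogeneous_part_sum: "homogeneous_part d (\<Sum>i\<in>I. f i) = (\<Sum>i\<in>I. homogeneous_part d (f i))"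
  by (rule poly_mapping_eqI) (simp add: lookup_homogeneous_part lookup_sum)

lemma homogeneous_part_const_mult: "homogeneous_part d (const c * f) = const c * homogeneous_part d f"
  by (rule poly_mapping_eqI) (simp add: lookup_homogeneous_part)

lemma homogeneous_part_homogeneous:
  "homogeneous e f \<Longrightarrow> homogeneous_part d f = (if d = e then f else 0)"
  by (rule poly_mapping_eqI) (auto simp: lookup_homogeneous_part homogeneous_iff)

lemma homogeneous_part_single:
  "homogeneous_part d (Poly_Mapping.single a c) = (if tdeg a = d then Poly_Mapping.single a c else 0)"
  by (rule poly_mapping_eqI) (auto simp: lookup_homogeneous_part lookup_single when_def)

lemma homogeneous_part_mult:
  "homogeneous_part d (f * g) = (\<Sum>j\<le>d. homogeneous_part j f * homogeneous_part (d - j) g)"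
proof (induction f rule: poly_mapping_single_induct)
  case (single a c)
  show ?case
  proof (induction g rule: poly_mapping_single_induct)
    case (single b c')
    have "(\<Sum>j\<le>d. homogeneous_part j (Poly_Mapping.single a c) * homogeneous_part (d - j) (Poly_Mapping.single b c')) =
      (\<Sum>j\<le>d. if j = tdeg a then (if tdeg b = d - j then Poly_Mapping.single (a + b) (c * c') else 0) else 0)"
      by (intro sum.cong) (auto simp: homogeneous_part_single mult_single)
    thus ?case by (auto simp: mult_single homogeneous_part_single tdeg_add)
  qed (auto simp: homogeneous_part_add algebra_simps sum.distrib)
qed (auto simp: homogeneous_part_add algebra_simps sum.distrib)

lemma sum_homogeneous_part:
  assumes "finite D" "tdeg ` keys f \<subseteq> D"
  shows "(\<Sum>d\<in>D. homogeneous_part d f) = f"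
proof (rule poly_mapping_eqI)
  fix a
  show "lookup (\<Sum>d\<in>D. homogeneous_part d f) a = lookup f a"
  proof (cases "a \<in> keys f")
    case True
    hence "tdeg a \<in> D" using assms by blast
    thus ?thesis using assms by (simp add: lookup_sum lookup_homogeneous_part)
  next
    case False
    thus ?thesis by (auto simp: lookup_sum lookup_homogeneous_part in_keys_iff intro!: sum.neutral)
  qed
qed

lemma homogeneous_part_in_harmonic_space:
  assumes "g \<in> harmonic_space Z"
  shows "homogeneous_part d g \<in> harmonic_space Z"
  unfolding harmonic_space_iff
proof (intro ballI impI)
  fix f :: "'a cpoly" assume f: "f \<in> vanishing_ideal Z" "f \<noteq> 0"
  obtain e where "top_part f = homogeneous_part e f"
    using top_part_eq[OF f(2)] by metis
  moreover have "diff_op (top_part f) g = 0"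
    using assms f by (auto simp: harmonic_space_iff)
  ultimately show "diff_op (top_part f) (homogeneous_part d g) = 0"
    using diff_op_homogeneous[OF homogeneous_homogeneous_part[of e f], of d g] by simp
qed

lemma harmonic_space_0 [simp]: "0 \<in> harmonic_space Z"
  by (simp add: harmonic_space_iff)

lemma harmonic_space_add: "f \<in> harmonic_space Z \<Longrightarrow> g \<in> harmonic_space Z \<Longrightarrow> f + g \<in> harmonic_space Z"
  by (simp add: harmonic_space_iff diff_op_add_right)

lemma harmonic_space_sum: "(\<And>i. i \<in> I \<Longrightarrow> f i \<in> harmonic_space Z) \<Longrightarrow> (\<Sum>i\<in>I. f i) \<in> harmonic_space Z"
  by (induction I rule: infinite_finite_induct) (auto intro: harmonic_space_add)

lemma harmonic_space_const_mult: "f \<in> harmonic_space Z \<Longrightarrow> const c * f \<in> harmonic_space Z"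
  by (simp add: harmonic_space_iff diff_op_const_mult)

lemma const_uminus_one_mult: "const (-1) * f = - (f :: 'n::finite cpoly)"
  by (rule poly_mapping_eqI) simp

lemma harmonic_space_uminus: "f \<in> harmonic_space Z \<Longrightarrow> - f \<in> harmonic_space Z"
  using harmonic_space_const_mult[of f Z "-1"] by (simp add: const_uminus_one_mult)

text \<open>If \<open>q\<close> vanishes on \<open>Z\<close>, then \<open>q(\<partial>)\<close>
  kills the whole series \<open>f(e^y)\<close>, since it multiplies \<open>e^L\<close> by
  \<open>q(p)\<close>. In degree \<open>d - e\<close>, where \<open>e = deg q\<close>, only the top
  part of \<open>q\<close> acting on the degree \<open>d\<close> part of the series contributes:
  lower parts of \<open>q\<close> would act on degrees below \<open>d\<close>, where the series is
  zero.\<close>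

lemma exp_part_in_harmonic_space:
  fixes f :: "'n::finite laurent"
  assumes "keys f \<subseteq> Z" and van: "\<And>j. j < d \<Longrightarrow> exp_part j f = 0"
  shows "exp_part d f \<in> harmonic_space (of_int_vec ` Z)"
  unfolding harmonic_space_iff
proof (intro ballI impI poly_mapping_eqI)
  fix q :: "'n cpoly" and b
  assume q: "q \<in> vanishing_ideal (of_int_vec ` Z)" "q \<noteq> 0"
  obtain e where e: "top_part q = homogeneous_part e q" "\<And>a. e < tdeg a \<Longrightarrow> lookup q a = 0"
    using top_part_eq[OF q(2)] by metis
  define F where "F = (\<lambda>a::nat ^ 'n. \<Prod>i\<in>UNIV. fact (a $ i) :: complex)"
  define pw where "pw = (\<lambda>(p::int^'n) (a::nat ^ 'n). \<Prod>i\<in>UNIV. of_int (p $ i) ^ (a $ i) :: complex)"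
  have F: "F a \<noteq> 0" for a by (simp add: F_def)
  have ec: "exp_coeff p a = pw p a / F a" for p a
    by (simp add: exp_coeff_def pw_def F_def prod_dividef)
  have pw_add: "pw p (a + b) = pw p a * pw p b" for p a b
    by (simp add: pw_def power_add prod.distrib)
  have moments: "(\<Sum>p\<in>keys f. lookup f p * pw p a) = 0" if "tdeg a < d" for a
  proof -
    have "lookup (exp_part (tdeg a) f) a = 0" using van[OF that] by simp
    hence "(\<Sum>p\<in>keys f. lookup f p * exp_coeff p a) = 0" by (simp add: lookup_exp_part)
    hence "(\<Sum>p\<in>keys f. lookup f p * pw p a) / F a = 0"
      by (simp add: ec sum_divide_distrib)
    thus ?thesis using F by simp
  qed
  have "lookup (diff_op (top_part q) (exp_part d f)) b =
    (\<Sum>a\<in>keys q. lookup (top_part q) a * (F (a + b) / F b * lookup (exp_part d f) (a + b)))"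
    by (subst lookup_diff_op_superset[of "keys q"])
       (auto simp: e(1) F_def in_keys_iff lookup_homogeneous_part prod_dividef split: if_splits)
  \<comment> \<open>The top part of \<open>q\<close> is replaced by all of \<open>q\<close>: an
    added term has \<open>tdeg a < e\<close>, hence \<open>tdeg (a + b) < d\<close>, and its moment
    is zero.\<close>
  also have "\<dots> = (\<Sum>a\<in>keys q. if tdeg b + e = d then
    lookup q a * (1 / F b * (\<Sum>p\<in>keys f. lookup f p * pw p (a + b))) else 0)"
  proof (rule sum.cong[OF refl])
    fix a assume "a \<in> keys q"
    hence a: "tdeg a \<le> e" using e(2)[of a] by (force simp: in_keys_iff not_less)
    have *: "F (a + b) / F b * (\<Sum>p\<in>keys f. lookup f p * exp_coeff p (a + b)) =
      1 / F b * (\<Sum>p\<in>keys f. lookup f p * pw p (a + b))"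
      by (simp add: ec F flip: sum_divide_distrib)
    show "lookup (top_part q) a * (F (a + b) / F b * lookup (exp_part d f) (a + b)) =
      (if tdeg b + e = d then lookup q a * (1 / F b * (\<Sum>p\<in>keys f. lookup f p * pw p (a + b))) else 0)"
    proof (cases "tdeg a = e")
      case True
      thus ?thesis using * F[of b]
        by (auto simp: e(1) lookup_homogeneous_part lookup_exp_part tdeg_add add.commute[of e])
    next
      case False
      thus ?thesis using a moments[of "a + b"] by (simp add: e(1) lookup_homogeneous_part tdeg_add)
    qed
  qed
  also have "\<dots> = 0"
  proof (cases "tdeg b + e = d")
    case True
    \<comment> \<open>Exchanging the sums isolates the value of \<open>q\<close> at each exponent
      \<open>p\<close>.\<close>
    have "(\<Sum>a\<in>keys q. lookup q a * (1 / F b * (\<Sum>p\<in>keys f. lookup f p * pw p (a + b)))) =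
      1 / F b * (\<Sum>p\<in>keys f. lookup f p * pw p b * (\<Sum>a\<in>keys q. lookup q a * pw p a))"
      by (simp add: pw_add sum_distrib_left sum_distrib_right mult_ac)
         (subst sum.swap, simp add: mult_ac)
    also have "(\<Sum>p\<in>keys f. lookup f p * pw p b * (\<Sum>a\<in>keys q. lookup q a * pw p a)) = 0"
    proof (rule sum.neutral, intro ballI)
      fix p assume "p \<in> keys f"
      hence "cpoly_eval q (of_int_vec p) = 0"
        using q(1) assms(1) by (auto simp: vanishing_ideal_def)
      thus "lookup f p * pw p b * (\<Sum>a\<in>keys q. lookup q a * pw p a) = 0"
        by (simp add: cpoly_eval_def of_int_vec_def pw_def)
    qed
    finally show ?thesis using True by simp
  qed simp
  finally show "lookup (diff_op (top_part q) (exp_part d f)) b = lookup 0 b" by simp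
qed

text \<open>The Fredholm alternative: a functional vanishing on the common kernel of finitely many
  functionals is a combination of them. The induction passes to the kernel of one functional, so
  \<open>W\<close> must vary; it is a subset closed under linear combinations rather than a whole
  space.\<close>

lemma functional_in_span:
  fixes f :: "'p \<Rightarrow> 'n::finite cpoly \<Rightarrow> complex" and b :: "'n cpoly \<Rightarrow> complex"
  assumes "finite Z"
    and W: "\<And>u v c. u \<in> W \<Longrightarrow> v \<in> W \<Longrightarrow> u + const c * v \<in> W"
    and f: "\<And>p u v c. p \<in> Z \<Longrightarrow> u \<in> W \<Longrightarrow> v \<in> W \<Longrightarrow> f p (u + const c * v) = f p u + c * f p v"
    and b: "\<And>u v c. u \<in> W \<Longrightarrow> v \<in> W \<Longrightarrow> b (u + const c * v) = b u + c * b v"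
    and ker: "\<And>w. w \<in> W \<Longrightarrow> (\<And>p. p \<in> Z \<Longrightarrow> f p w = 0) \<Longrightarrow> b w = 0"
  shows "\<exists>c. \<forall>w\<in>W. b w = (\<Sum>p\<in>Z. c p * f p w)"
  using assms
proof (induction Z arbitrary: W rule: finite_induct)
  case (insert q Z)
  note W = insert.prems(1) and f = insert.prems(2) and b = insert.prems(3)
  have "\<exists>c. \<forall>w\<in>{w \<in> W. f q w = 0}. b w = (\<Sum>p\<in>Z. c p * f p w)"
  proof (rule insert.IH)
    fix w assume "w \<in> {w \<in> W. f q w = 0}" "\<And>p. p \<in> Z \<Longrightarrow> f p w = 0"
    thus "b w = 0" using insert.prems(4)[of w] by blast
  qed (use W f b in auto)
  then obtain c where c: "\<And>w. w \<in> W \<Longrightarrow> f q w = 0 \<Longrightarrow> b w = (\<Sum>p\<in>Z. c p * f p w)"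
    by blast
  show ?case
  proof (cases "\<forall>w\<in>W. f q w = 0")
    case True
    have "b w = (\<Sum>p\<in>insert q Z. c p * f p w)" if "w \<in> W" for w
      using c[OF that] True that insert.hyps by simp
    thus ?thesis by blast
  next
    case False
    then obtain v where v: "v \<in> W" "f q v \<noteq> 0" by blast
    \<comment> \<open>On the kernel of \<open>f q\<close> the value \<open>c' q\<close> is
      irrelevant; it is chosen so that both sides agree at \<open>v\<close>, which together with
      that kernel spans \<open>W\<close>.\<close>
    define c' where "c' = c(q := (b v - (\<Sum>p\<in>Z. c p * f p v)) / f q v)"
    have "b w = (\<Sum>p\<in>insert q Z. c' p * f p w)" if w: "w \<in> W" for w
    proof -
      \<comment> \<open>Projects \<open>w\<close> along \<open>v\<close> into the kernel of
        \<open>f q\<close>.\<close>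
      define k where "k = - (f q w / f q v)"
      have "f q (w + const k * v) = 0" using f[of q w v k] v w by (simp add: k_def)
      hence "b (w + const k * v) = (\<Sum>p\<in>Z. c p * f p (w + const k * v))"
        using c[of "w + const k * v"] W[OF w v(1)] by simp
      hence "b w + k * b v = (\<Sum>p\<in>Z. c p * (f p w + k * f p v))"
        using f[of _ w v k] b[OF w v(1)] v(1) w by simp
      also have "\<dots> = (\<Sum>p\<in>Z. c p * f p w) + k * (\<Sum>p\<in>Z. c p * f p v)"
        by (simp add: algebra_simps sum.distrib sum_distrib_left)
      finally have "b w = (\<Sum>p\<in>Z. c p * f p w) - k * (b v - (\<Sum>p\<in>Z. c p * f p v))"
        by (simp add: algebra_simps)
      moreover have "(\<Sum>p\<in>Z. c' p * f p w) = (\<Sum>p\<in>Z. c p * f p w)"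
        using insert.hyps by (intro sum.cong) (auto simp: c'_def)
      ultimately show ?thesis using insert.hyps by (simp add: c'_def k_def)
    qed
    thus ?thesis by blast
  qed
qed auto

text \<open>The functional \<open>q \<mapsto> (q(\<partial>) g)(0)\<close> on polynomials of degree
  at most \<open>d\<close> kills those vanishing on \<open>Z\<close>, so it is a combination of
  evaluations at points of \<open>Z\<close>. The coefficients of this combination are those of the
  desired Laurent polynomial.\<close>

lemma harmonic_space_imp_exp_part:
  fixes g :: "'n::finite cpoly" and Z :: "(int ^ 'n) set"
  assumes "finite Z" and g: "g \<in> harmonic_space (of_int_vec ` Z)" "homogeneous d g"
  obtains f where "keys f \<subseteq> Z" "\<And>j. j < d \<Longrightarrow> exp_part j f = 0" "exp_part d f = g"
proof -
  define F where "F = (\<lambda>a::nat ^ 'n. \<Prod>i\<in>UNIV. fact (a $ i) :: complex)"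
  define pw where "pw = (\<lambda>(p::int^'n) (a::nat ^ 'n). \<Prod>i\<in>UNIV. of_int (p $ i) ^ (a $ i) :: complex)"
  have F: "F a \<noteq> 0" for a by (simp add: F_def)
  have ec: "exp_coeff p a = pw p a / F a" for p a
    by (simp add: exp_coeff_def pw_def F_def prod_dividef)
  \<comment> \<open>Degrees below \<open>d\<close> are included because testing on their monomials
    gives the vanishing of the lower parts of \<open>f\<close>.\<close>
  define W :: "'n cpoly set" where "W = {q. \<forall>a\<in>keys q. tdeg a \<le> d}"
  define ev where "ev = (\<lambda>(p::int^'n) (q :: 'n cpoly). \<Sum>a\<in>keys q. lookup q a * pw p a)"
  \<comment> \<open>The constant term of \<open>diff_op q g\<close>.\<close>
  define b where "b = (\<lambda>q. \<Sum>a\<in>keys q. lookup q a * (F a * lookup g a))"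
  have keys_linear: "(\<Sum>a\<in>keys (u + const c * v). lookup (u + const c * v) a * \<phi> a) =
     (\<Sum>a\<in>keys u. lookup u a * \<phi> a) + c * (\<Sum>a\<in>keys v. lookup v a * \<phi> a)"
    for u v :: "'n cpoly" and c and \<phi> :: "nat ^ 'n \<Rightarrow> complex"
  proof -
    have S: "finite (keys u \<union> keys v)" "keys u \<subseteq> keys u \<union> keys v"
      "keys v \<subseteq> keys u \<union> keys v" "keys (u + const c * v) \<subseteq> keys u \<union> keys v"
      by (auto simp: in_keys_iff lookup_add)
    show ?thesis
      using sum_keys_superset[OF S(1,2), of "\<lambda>a x. x * \<phi> a"] sum_keys_superset[OF S(1,3), of "\<lambda>a x. x * \<phi> a"]
        sum_keys_superset[OF S(1,4), of "\<lambda>a x. x * \<phi> a"]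
      by (simp add: lookup_add distrib_right sum.distrib sum_distrib_left mult.assoc)
  qed
  have "\<exists>c. \<forall>w\<in>W. b w = (\<Sum>p\<in>Z. c p * ev p w)"
  proof (rule functional_in_span[OF \<open>finite Z\<close>])
    fix w assume w: "w \<in> W" and ker: "\<And>p. p \<in> Z \<Longrightarrow> ev p w = 0"
    have wd: "lookup w a = 0" if "d < tdeg a" for a
      using w that by (force simp: W_def in_keys_iff)
    \<comment> \<open>If \<open>w\<close> has no part of degree \<open>d\<close>, it pairs to zero
      with \<open>g\<close> by degree. Otherwise that part is the top part of \<open>w\<close>, and
      harmonicity of \<open>g\<close> applies.\<close>
    show "b w = 0"
    proof (cases "homogeneous_part d w = 0")
      case True
      have "lookup w a * (F a * lookup g a) = 0" for a
        using g(2) lookup_homogeneous_part[of d w a] True by (cases "tdeg a = d") (auto simp: homogeneous_iff)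
      thus ?thesis unfolding b_def by (intro sum.neutral) blast
    next
      case False
      hence "w \<noteq> 0" by auto
      then obtain e where e: "top_part w = homogeneous_part e w" "\<And>a. e < tdeg a \<Longrightarrow> lookup w a = 0"
        "\<exists>a. tdeg a = e \<and> lookup w a \<noteq> 0"
        using top_part_eq by metis
      from False obtain a where "lookup (homogeneous_part d w) a \<noteq> 0"
        by (metis poly_mapping_eqI lookup_zero)
      hence "tdeg a = d" "lookup w a \<noteq> 0" by (auto simp: lookup_homogeneous_part split: if_splits)
      hence "e = d" using e(2)[of a] e(3) wd by (metis linorder_neqE_nat)
      have "w \<in> vanishing_ideal (of_int_vec ` Z)"
        using ker by (auto simp: vanishing_ideal_def cpoly_eval_def ev_def pw_def of_int_vec_def)
      hence "diff_op (homogeneous_part d w) g = 0"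
        using g(1) \<open>w \<noteq> 0\<close> e(1) \<open>e = d\<close> by (auto simp: harmonic_space_iff)
      hence "0 = lookup (diff_op (homogeneous_part d w) g) 0" by simp
      also have "\<dots> = (\<Sum>a\<in>keys w. lookup (homogeneous_part d w) a * (F a * lookup g a))"
        by (subst lookup_diff_op_superset[of "keys w"])
           (auto simp: F_def in_keys_iff lookup_homogeneous_part split: if_splits)
      also have "\<dots> = b w"
        unfolding b_def using g(2) by (intro sum.cong) (auto simp: lookup_homogeneous_part homogeneous_iff)
      finally show ?thesis by simp
    qed
  next
    fix u v :: "'n cpoly" and c assume uv: "u \<in> W" "v \<in> W"
    have "tdeg a \<le> d" if "a \<in> keys (u + const c * v)" for a
      using that uv by (cases "a \<in> keys u"; cases "a \<in> keys v") (auto simp: W_def in_keys_iff lookup_add)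
    thus "u + const c * v \<in> W" by (simp add: W_def)
  qed (auto simp: ev_def b_def keys_linear)
  then obtain c where c: "\<And>w. w \<in> W \<Longrightarrow> b w = (\<Sum>p\<in>Z. c p * ev p w)" by blast
  \<comment> \<open>Evaluated at the monomial with exponent \<open>a\<close>, the identity of
    functionals prescribes the moments of the coefficients \<open>c\<close>.\<close>
  have mom: "F a * lookup g a = (\<Sum>p\<in>Z. c p * pw p a)" if "tdeg a \<le> d" for a
    using c[of "Poly_Mapping.single a 1"] that by (simp add: W_def b_def ev_def)
  define f where "f = (\<Sum>p\<in>Z. Poly_Mapping.single p (c p))"
  have look_f: "lookup f p = (if p \<in> Z then c p else 0)" for p
    using \<open>finite Z\<close> by (simp add: f_def lookup_sum lookup_single when_def)
  have keys: "keys f \<subseteq> Z" by (auto simp: in_keys_iff look_f split: if_splits)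
  have ex: "lookup (exp_part j f) a = (if tdeg a = j then lookup g a else 0)" if "j \<le> d" for j a
  proof (cases "tdeg a = j")
    case True
    have "lookup (exp_part j f) a = (\<Sum>p\<in>Z. c p * pw p a) / F a"
      using True by (simp add: lookup_exp_part_superset[OF \<open>finite Z\<close> keys] look_f ec sum_divide_distrib)
    also have "(\<Sum>p\<in>Z. c p * pw p a) = F a * lookup g a" using mom[of a] True that by simp
    finally show ?thesis using True F[of a] by simp
  qed (simp add: lookup_exp_part)
  show thesis
  proof (rule that[OF keys])
    show "exp_part j f = 0" if "j < d" for j
      using that g(2) by (intro poly_mapping_eqI) (auto simp: ex homogeneous_iff)
    show "exp_part d f = g"
      using g(2) by (intro poly_mapping_eqI) (auto simp: ex homogeneous_iff)
  qed
qed

subsection \<open>Order of vanishing\<close>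

text \<open>
  Under \<open>x = e\<^sup>y\<close> the operator \<open>x\<^sub>i \<partial>/\<partial>x\<^sub>i\<close> becomes \<open>\<partial>/\<partial>y\<^sub>i\<close>, and the unit \<open>x\<^sub>i\<close> does not affect
  orders of vanishing.
\<close>

definition euler :: "'n::finite \<Rightarrow> 'n laurent \<Rightarrow> 'n laurent" where
  "euler i f = Poly_Mapping.single (axis i 1) 1 * laurent_partial i f"

lemma lookup_euler: "lookup (euler i f) p = of_int (p $ i) * lookup f p"
proof -
  have "euler i f = (\<Sum>q\<in>keys f. Poly_Mapping.single q (of_int (q $ i) * lookup f q))"
    by (simp add: euler_def laurent_partial_def sum_distrib_left mult_single)
  thus ?thesis by (auto simp: lookup_sum lookup_single when_def in_keys_iff)
qed

lemma laurent_partial_eq_euler: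
  "laurent_partial i f = Poly_Mapping.single (- axis i 1) 1 * euler i f"
  by (simp add: euler_def mult_single flip: mult.assoc)

lemma partial_exp_part: "partial i (exp_part (Suc d) f) = exp_part d (euler i f)"
proof (rule poly_mapping_eqI)
  fix b
  have *: "keys (euler i f) \<subseteq> keys f" by (auto simp: in_keys_iff lookup_euler)
  have "of_nat (b $ i + 1) * (lookup f p * exp_coeff p (b + axis i 1)) =
      lookup (euler i f) p * exp_coeff p b" for p
    using exp_coeff_add_axis[of b i p] by (simp add: lookup_euler algebra_simps)
  thus "lookup (partial i (exp_part (Suc d) f)) b = lookup (exp_part d (euler i f)) b"
    unfolding lookup_partial lookup_exp_part_superset[OF finite_keys *] lookup_exp_part[of "Suc d" f]
    by (simp add: tdeg_add sum_distrib_left)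
qed

text \<open>In positive degree each monomial contains some variable, and differentiating by it
  multiplies the coefficient by a nonzero integer. Constants show why the degree is
  \<open>Suc d\<close>.\<close>

lemma homogeneous_partial_eq_0:
  assumes "homogeneous (Suc d) g" "\<And>i. partial i g = 0"
  shows "g = 0"
proof (rule poly_mapping_eqI)
  fix a
  show "lookup g a = lookup 0 a"
  proof (cases "tdeg a = Suc d")
    case True
    then obtain i where i: "a $ i \<noteq> 0" by (fastforce simp: tdeg_def)
    show ?thesis
    proof (cases a i rule: vec_nat_axis_cases)
      case (2 b)
      thus ?thesis using assms(2)[of i] lookup_partial[of i g b] by (simp del: of_nat_Suc)
    qed (use i in simp)
  qed (use assms in \<open>auto simp: homogeneous_iff\<close>)
qed

text \<open>Multiplying by a monomial cannot lower the order of vanishing. Since a Laurent monomial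
  is a unit, using this for it and for its inverse gives equality.\<close>

lemma exp_part_single_mult_vanishing:
  assumes "\<And>j. j < d \<Longrightarrow> exp_part j f = 0" "j < d"
  shows "exp_part j (Poly_Mapping.single p c * f) = 0"
  using assms by (simp add: exp_part_mult)

lemma laurent_eval_vec_1: "laurent_eval f (vec 1) = (\<Sum>p\<in>keys f. lookup f p)"
  by (simp add: laurent_eval_def)

lemma exp_part_zero_eq: "exp_part 0 f = const (laurent_eval f (vec 1))"
  unfolding laurent_eval_vec_1
  by (rule poly_mapping_eqI) (simp add: exp_part_def lookup_sum lookup_single when_def)

text \<open>Both sides obey the same recursion: order \<open>d + 1\<close> for \<open>f\<close>
  means a zero value at \<open>e\<close> and order \<open>d\<close> for all first derivatives, where
  ordinary and Euler derivatives may be exchanged.\<close>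

lemma vanishing_iff_exp_part:
  fixes f :: "'n::finite laurent"
  shows "(\<forall>is. length is < d \<longrightarrow> laurent_eval (foldr laurent_partial is f) (vec 1) = 0)
    \<longleftrightarrow> (\<forall>j<d. exp_part j f = 0)"
proof (induction d arbitrary: f)
  case (Suc d)
  have "(\<forall>is. length is < Suc d \<longrightarrow> laurent_eval (foldr laurent_partial is f) (vec 1) = 0) \<longleftrightarrow>
    laurent_eval f (vec 1) = 0 \<and>
    (\<forall>i is. length is < d \<longrightarrow> laurent_eval (foldr laurent_partial is (laurent_partial i f)) (vec 1) = 0)"
    (is "?L \<longleftrightarrow> ?R")
  proof
    assume L: ?L
    show ?R
    proof (intro conjI allI impI)
      show "laurent_eval f (vec 1) = 0" using L[rule_format, of "[]"] by simp
      show "laurent_eval (foldr laurent_partial is (laurent_partial i f)) (vec 1) = 0"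
        if "length is < d" for i "is"
        \<comment> \<open>Under \<open>foldr\<close> the last entry of the list acts first, so lists
          are split at their end.\<close>
        using L[rule_format, of "is @ [i]"] that by simp
    qed
  next
    assume R: ?R
    show ?L
    proof (intro allI impI)
      fix "is" :: "'n list" assume "length is < Suc d"
      thus "laurent_eval (foldr laurent_partial is f) (vec 1) = 0"
        using R by (cases "is" rule: rev_cases) auto
    qed
  qed
  also have "\<dots> \<longleftrightarrow> laurent_eval f (vec 1) = 0 \<and> (\<forall>i. \<forall>j<d. exp_part j (laurent_partial i f) = 0)"
    using Suc by blast
  also have "\<dots> \<longleftrightarrow> exp_part 0 f = 0 \<and> (\<forall>i. \<forall>j<d. exp_part j (euler i f) = 0)"
  proof -
    have "(\<forall>j<d. exp_part j (laurent_partial i f) = 0) \<longleftrightarrow> (\<forall>j<d. exp_part j (euler i f) = 0)" for i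
      using exp_part_single_mult_vanishing[of d "laurent_partial i f" _ "axis i 1" 1]
        exp_part_single_mult_vanishing[of d "euler i f" _ "- axis i 1" 1]
      unfolding laurent_partial_eq_euler[symmetric] euler_def[symmetric] by blast
    moreover have "laurent_eval f (vec 1) = 0 \<longleftrightarrow> exp_part 0 f = 0"
      by (metis exp_part_zero_eq lookup_single_eq single_zero)
    ultimately show ?thesis by blast
  qed
  also have "\<dots> \<longleftrightarrow> exp_part 0 f = 0 \<and> (\<forall>j<d. exp_part (Suc j) f = 0)"
  proof -
    have "(\<forall>i. exp_part j (euler i f) = 0) \<longleftrightarrow> exp_part (Suc j) f = 0" for j
      using homogeneous_partial_eq_0[OF homogeneous_exp_part[of "Suc j" f]]
      by (auto simp flip: partial_exp_part) (auto simp: partial_def)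
    thus ?thesis by blast
  qed
  also have "\<dots> \<longleftrightarrow> (\<forall>j<Suc d. exp_part j f = 0)"
    by (metis Suc_less_eq less_Suc_eq_0_disj)
  finally show ?case .
qed simp

lemma vanishing_order_ge_iff:
  "enat d \<le> vanishing_order f (vec 1) \<longleftrightarrow> (\<forall>j<d. exp_part j f = 0)"
proof -
  have "enat d \<le> vanishing_order f (vec 1) \<longleftrightarrow>
    (\<forall>is. laurent_eval (foldr laurent_partial is f) (vec 1) \<noteq> 0 \<longrightarrow> d \<le> length is)"
    by (auto simp: vanishing_order_def le_Inf_iff)
  also have "\<dots> \<longleftrightarrow> (\<forall>is. length is < d \<longrightarrow> laurent_eval (foldr laurent_partial is f) (vec 1) = 0)"
    by (meson not_le)
  finally show ?thesis unfolding vanishing_iff_exp_part .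
qed


subsection \<open>Transport of structure\<close>

text \<open>Only \<open>A\<close> has to be known to be a bigraded algebra; all axioms for
  \<open>B\<close> are carried along \<open>h\<close>.\<close>

lemma bigraded_isomorphicI:
  fixes A :: "'a bigraded" and B :: "'b bigraded"
  assumes A: "bigraded_algebra A"
    and bij: "bij_betw h (carrier A) (carrier B)"
    and mult: "\<And>x y. x \<in> carrier A \<Longrightarrow> y \<in> carrier A \<Longrightarrow> h (x \<otimes>\<^bsub>A\<^esub> y) = h x \<otimes>\<^bsub>B\<^esub> h y"
    and add: "\<And>x y. x \<in> carrier A \<Longrightarrow> y \<in> carrier A \<Longrightarrow> h (x \<oplus>\<^bsub>A\<^esub> y) = h x \<oplus>\<^bsub>B\<^esub> h y"
    and one: "h \<one>\<^bsub>A\<^esub> = \<one>\<^bsub>B\<^esub>"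
    and zero: "h \<zero>\<^bsub>A\<^esub> = \<zero>\<^bsub>B\<^esub>"
    and smult: "\<And>c x. x \<in> carrier A \<Longrightarrow> h (c \<odot>\<^bsub>A\<^esub> x) = c \<odot>\<^bsub>B\<^esub> h x"
    and comp: "\<And>m d. h ` component A m d = component B m d"
  shows "bigraded_isomorphic A B"
proof -
  interpret A: bigraded_algebra A by (rule A)
  have hclosed: "h x \<in> carrier B" if "x \<in> carrier A" for x
    using bij that by (auto simp: bij_betw_def)
  have hinj: "h x = h y \<longleftrightarrow> x = y" if "x \<in> carrier A" "y \<in> carrier A" for x y
    using bij that by (auto simp: bij_betw_def inj_on_def)
  have hsurj: "\<exists>x\<in>carrier A. y = h x" if "y \<in> carrier B" for y
    using bij that by (auto simp: bij_betw_def)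
  have iso: "h \<in> ring_iso A B"
    unfolding ring_iso_def ring_hom_def using hclosed mult add one bij by auto
  have "cring (B\<lparr>zero := h \<zero>\<^bsub>A\<^esub>\<rparr>)" by (rule cring.ring_iso_imp_img_cring[OF A.M_cring iso])
  hence cringB: "cring B" by (simp add: zero)
  interpret BC: cring B by (rule cringB)
  interpret hom: ring_hom_cring A B h
    by unfold_locales (use iso in \<open>simp add: ring_iso_def\<close>)
  have algB: "algebra (univ_ring :: complex ring) B"
  proof (rule algebraI[OF cring_univ_ring cringB])
    fix a b :: complex and x y assume x: "x \<in> carrier B" and y: "y \<in> carrier B"
    obtain x' y' where x': "x' \<in> carrier A" "x = h x'" and y': "y' \<in> carrier A" "y = h y'"
      using hsurj x y by blast
    have [simp]: "c \<in> carrier univ_ring" for c :: complex by (simp add: univ_ring_def)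
    have sc: "c \<odot>\<^bsub>A\<^esub> z \<in> carrier A" if "z \<in> carrier A" for c z
      using that by simp
    note simps = x'(2) y'(2) x'(1) y'(1) sc
    show "a \<odot>\<^bsub>B\<^esub> x \<in> carrier B"
      using hclosed[OF sc[OF x'(1)]] by (simp add: simps smult)
    show "(a \<oplus>\<^bsub>univ_ring\<^esub> b) \<odot>\<^bsub>B\<^esub> x = a \<odot>\<^bsub>B\<^esub> x \<oplus>\<^bsub>B\<^esub> b \<odot>\<^bsub>B\<^esub> x"
      using arg_cong[OF A.smult_l_distr[of a b x'], of h] by (simp add: simps smult)
    show "a \<odot>\<^bsub>B\<^esub> (x \<oplus>\<^bsub>B\<^esub> y) = a \<odot>\<^bsub>B\<^esub> x \<oplus>\<^bsub>B\<^esub> a \<odot>\<^bsub>B\<^esub> y"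
      using arg_cong[OF A.smult_r_distr[of a x' y'], of h] by (simp add: simps smult)
    show "(a \<otimes>\<^bsub>univ_ring\<^esub> b) \<odot>\<^bsub>B\<^esub> x = a \<odot>\<^bsub>B\<^esub> (b \<odot>\<^bsub>B\<^esub> x)"
      using arg_cong[OF A.smult_assoc1[of a b x'], of h] by (simp add: simps smult)
    show "\<one>\<^bsub>univ_ring\<^esub> \<odot>\<^bsub>B\<^esub> x = x"
      unfolding x'(2) smult[OF x'(1), symmetric] A.smult_one[OF x'(1)] ..
    show "(a \<odot>\<^bsub>B\<^esub> x) \<otimes>\<^bsub>B\<^esub> y = a \<odot>\<^bsub>B\<^esub> (x \<otimes>\<^bsub>B\<^esub> y)"
      using arg_cong[OF A.smult_assoc2[of a x' y'], of h] by (simp add: simps smult)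
  qed
  then interpret B: algebra "univ_ring :: complex ring" B .
  have compA: "component A m d \<subseteq> carrier A" for m d
    using subgroup.subset[OF submodule.axioms(1)[OF A.component_submodule[of m d]]] by simp
  have hcomp: "h x \<in> component B m d" if "x \<in> component A m d" for x m d
    unfolding comp[symmetric] using that by (rule imageI)
  have compE: "\<exists>x'. x' \<in> component A m d \<and> x' \<in> carrier A \<and> x = h x'" if "x \<in> component B m d" for x m d
    using that compA[of m d] unfolding comp[symmetric] by blast
  have "bigraded_algebra B"
  proof (rule bigraded_algebra.intro[OF algB bigraded_algebra_axioms.intro])
    fix m d
    interpret sub: submodule "component A m d" "univ_ring :: complex ring" A
      by (rule A.component_submodule)
    show "submodule (component B m d) (univ_ring :: complex ring) B"
    proof (rule B.submoduleI)
      show "component B m d \<subseteq> carrier B" using compE hclosed by blast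
      have "\<zero>\<^bsub>A\<^esub> \<in> component A m d" using sub.one_closed by simp
      thus "\<zero>\<^bsub>B\<^esub> \<in> component B m d" unfolding zero[symmetric] by (rule hcomp)
    next
      fix x assume "x \<in> component B m d"
      then obtain x' where x': "x' \<in> component A m d" "x' \<in> carrier A" "x = h x'" using compE by blast
      have "\<ominus>\<^bsub>A\<^esub> x' \<in> component A m d" using sub.m_inv_closed[OF x'(1)] by (simp add: a_inv_def)
      hence "h (\<ominus>\<^bsub>A\<^esub> x') \<in> component B m d" by (rule hcomp)
      thus "\<ominus>\<^bsub>B\<^esub> x \<in> component B m d" using x' by simp
    next
      fix a :: complex and x assume "x \<in> component B m d"
      then obtain x' where x': "x' \<in> component A m d" "x' \<in> carrier A" "x = h x'" using compE by blast
      have "a \<odot>\<^bsub>A\<^esub> x' \<in> component A m d"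
        by (rule sub.smult_closed) (use x' in \<open>simp_all add: univ_ring_def\<close>)
      hence "h (a \<odot>\<^bsub>A\<^esub> x') \<in> component B m d" by (rule hcomp)
      thus "a \<odot>\<^bsub>B\<^esub> x \<in> component B m d" using x' by (simp add: smult)
    next
      fix x y assume "x \<in> component B m d" "y \<in> component B m d"
      then obtain x' y' where x': "x' \<in> component A m d" "x' \<in> carrier A" "x = h x'"
        and y': "y' \<in> component A m d" "y' \<in> carrier A" "y = h y'" using compE by meson
      have "x' \<oplus>\<^bsub>A\<^esub> y' \<in> component A m d" using sub.m_closed[OF x'(1) y'(1)] by simp
      hence "h (x' \<oplus>\<^bsub>A\<^esub> y') \<in> component B m d" by (rule hcomp)
      thus "x \<oplus>\<^bsub>B\<^esub> y \<in> component B m d" using x' y' by simp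
    qed
  next
    show "\<one>\<^bsub>B\<^esub> \<in> component B 0 0" unfolding one[symmetric] by (rule hcomp[OF A.one_component])
  next
    fix x y m d m' d' assume "x \<in> component B m d" "y \<in> component B m' d'"
    then obtain x' y' where x': "x' \<in> component A m d" "x' \<in> carrier A" "x = h x'"
      and y': "y' \<in> component A m' d'" "y' \<in> carrier A" "y = h y'" using compE by meson
    have "h (x' \<otimes>\<^bsub>A\<^esub> y') \<in> component B (m + m') (d + d')"
      by (rule hcomp[OF A.mult_component[OF x'(1) y'(1)]])
    thus "x \<otimes>\<^bsub>B\<^esub> y \<in> component B (m + m') (d + d')" using x' y' by simp
  next
    fix y assume "y \<in> carrier B"
    then obtain x where x: "x \<in> carrier A" "y = h x" using hsurj by blast
    let ?Q = "\<lambda>c. (\<forall>m d. c (m, d) \<in> component A m d) \<and> finite {i. c i \<noteq> \<zero>\<^bsub>A\<^esub>} \<and>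
        x = (\<Oplus>\<^bsub>A\<^esub>i\<in>{i. c i \<noteq> \<zero>\<^bsub>A\<^esub>}. c i)"
    let ?R = "\<lambda>c. (\<forall>m d. c (m, d) \<in> component B m d) \<and> finite {i. c i \<noteq> \<zero>\<^bsub>B\<^esub>} \<and>
        y = (\<Oplus>\<^bsub>B\<^esub>i\<in>{i. c i \<noteq> \<zero>\<^bsub>B\<^esub>}. c i)"
    \<comment> \<open>Decompositions of \<open>x\<close> and of \<open>h x\<close> correspond:
      \<open>h\<close> commutes with finite sums, and by injectivity a family and its image have the
      same support.\<close>
    have QR: "?Q c \<longleftrightarrow> ?R (h \<circ> c)" if c: "\<And>m d. c (m, d) \<in> component A m d" for c
    proof -
      have cc: "c i \<in> carrier A" for i using c[of "fst i" "snd i"] compA by auto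
      have supp: "{i. (h \<circ> c) i \<noteq> \<zero>\<^bsub>B\<^esub>} = {i. c i \<noteq> \<zero>\<^bsub>A\<^esub>}"
        using hinj[OF cc A.M.zero_closed] by (auto simp: zero)
      have "(\<Oplus>\<^bsub>B\<^esub>i\<in>{i. c i \<noteq> \<zero>\<^bsub>A\<^esub>}. (h \<circ> c) i) = h (\<Oplus>\<^bsub>A\<^esub>i\<in>{i. c i \<noteq> \<zero>\<^bsub>A\<^esub>}. c i)"
        by (rule hom.hom_finsum[symmetric]) (use cc in auto)
      moreover have "(\<Oplus>\<^bsub>A\<^esub>i\<in>{i. c i \<noteq> \<zero>\<^bsub>A\<^esub>}. c i) \<in> carrier A"
        by (rule A.M.finsum_closed) (use cc in auto)
      ultimately have "x = (\<Oplus>\<^bsub>A\<^esub>i\<in>{i. c i \<noteq> \<zero>\<^bsub>A\<^esub>}. c i) \<longleftrightarrow> y = (\<Oplus>\<^bsub>B\<^esub>i\<in>{i. c i \<noteq> \<zero>\<^bsub>A\<^esub>}. (h \<circ> c) i)"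
        using hinj[OF x(1)] x(2) by simp
      moreover have "(h \<circ> c) (m, d) \<in> component B m d" for m d
        using hcomp[OF c] by simp
      ultimately show ?thesis unfolding supp using c by blast
    qed
    obtain c where c: "?Q c" and uniq: "\<And>c'. ?Q c' \<Longrightarrow> c' = c"
      using A.direct_sum[OF x(1)] by (elim ex1E) blast
    show "\<exists>!c. ?R c"
    proof (rule ex1I)
      show "?R (h \<circ> c)" using QR[of c] c by blast
      fix c' assume c': "?R c'"
      \<comment> \<open>Uniqueness is pulled back by lifting a competing family termwise into the
        components of \<open>A\<close>.\<close>
      have "\<exists>z. z \<in> component A (fst i) (snd i) \<and> h z = c' i" for i
      proof -
        have "c' (fst i, snd i) \<in> component B (fst i) (snd i)" using c' by blast
        thus ?thesis using compE[of "c' i"] by force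
      qed
      then obtain c'' where c'': "\<And>i. c'' i \<in> component A (fst i) (snd i)" "\<And>i. h (c'' i) = c' i"
        by metis
      have "c' = h \<circ> c''" using c''(2) by auto
      moreover have "?Q c''"
        using QR[of c''] c' c''(1)[of "(_, _)"] unfolding \<open>c' = h \<circ> c''\<close> by simp
      ultimately show "c' = h \<circ> c" using uniq by blast
    qed
  qed
  moreover have "h \<in> bigraded_iso A B"
    using iso smult comp by (auto simp: bigraded_iso_def)
  ultimately show ?thesis using A unfolding bigraded_isomorphic_def by blast
qed

subsection \<open>Lattice points of dilates\<close>

lemma finite_int_vec_bounded: "finite {p :: int ^ 'n::finite. \<forall>i. p $ i \<in> S i}" if "\<And>i. finite (S i)"
proof -
  have "finite (vec_lambda ` (PiE UNIV S :: ('n \<Rightarrow> int) set))"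
    using that by (intro finite_imageI finite_PiE) auto
  moreover have "{p :: int ^ 'n. \<forall>i. p $ i \<in> S i} \<subseteq> vec_lambda ` (PiE UNIV S)"
  proof
    fix p :: "int ^ 'n" assume "p \<in> {p. \<forall>i. p $ i \<in> S i}"
    thus "p \<in> vec_lambda ` (PiE UNIV S)" by (intro image_eqI[of _ _ "vec_nth p"]) auto
  qed
  ultimately show ?thesis by (rule finite_subset[rotated])
qed

lemma of_int_vec_add: "of_int_vec (p + q) = of_int_vec p + of_int_vec q"
  by (simp add: of_int_vec_def vec_eq_iff)

text \<open>Needed because the Fredholm alternative is applied to evaluations at these
  points.\<close>

lemma finite_dilate_points:
  assumes "lattice_polytope P"
  shows "finite (dilate_points P m)"
proof -
  obtain S :: "(int ^ 'a) set" where S: "finite S" "P = convex hull (of_int_vec ` S)"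
    using assms unfolding lattice_polytope_def by blast
  have "bounded P"
    unfolding S(2) by (intro bounded_convex_hull finite_imp_bounded finite_imageI S(1))
  hence "bounded ((\<lambda>x. real m *\<^sub>R x) ` P)" by (rule bounded_scaling)
  then obtain B where B: "\<And>x. x \<in> (\<lambda>x. real m *\<^sub>R x) ` P \<Longrightarrow> norm x \<le> B"
    unfolding bounded_iff by blast
  have "dilate_points P m \<subseteq> {p. \<forall>i. p $ i \<in> {-\<lceil>B\<rceil>..\<lceil>B\<rceil>}}"
  proof (intro subsetI CollectI allI)
    fix p i assume "p \<in> dilate_points P m"
    hence "norm (of_int_vec p :: real ^ 'a) \<le> B" using B by (simp only: dilate_points_def mem_Collect_eq)
    hence "\<bar>of_int_vec p $ i\<bar> \<le> B" using component_le_norm_cart[of "of_int_vec p :: real ^ 'a" i] by linarith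
    hence "real_of_int \<bar>p $ i\<bar> \<le> B" by (simp add: of_int_vec_def)
    hence "\<bar>p $ i\<bar> \<le> \<lceil>B\<rceil>" by linarith
    thus "p $ i \<in> {-\<lceil>B\<rceil>..\<lceil>B\<rceil>}" by auto
  qed
  moreover have "finite {p :: int ^ 'a. \<forall>i. p $ i \<in> {-\<lceil>B\<rceil>..\<lceil>B\<rceil>}}"
    by (rule finite_int_vec_bounded) simp
  ultimately show ?thesis by (rule finite_subset)
qed

text \<open>By convexity \<open>mP + m'P\<close> lies in \<open>(m + m')P\<close>: the witness is
  the average of the two points with weights proportional to \<open>m\<close> and
  \<open>m'\<close>.\<close>

lemma dilate_points_add:
  assumes "lattice_polytope P" "p \<in> dilate_points P m" "q \<in> dilate_points P m'"
  shows "p + q \<in> dilate_points P (m + m')"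
proof -
  have "convex P" using assms(1) by (auto simp: lattice_polytope_def convex_convex_hull)
  obtain x y where xy: "x \<in> P" "y \<in> P" "of_int_vec p = real m *\<^sub>R x" "of_int_vec q = real m' *\<^sub>R y"
    using assms(2,3) by (auto simp: dilate_points_def)
  show ?thesis
  proof (cases "m + m' = 0")
    \<comment> \<open>The weights would be \<open>0 / 0\<close>, but both lattice points are the
      origin, so any point of \<open>P\<close> is a witness.\<close>
    case True
    thus ?thesis using xy by (auto simp: dilate_points_def of_int_vec_add intro!: image_eqI[of _ _ x])
  next
    case False
    define u where "u = (real m / real (m + m')) *\<^sub>R x + (real m' / real (m + m')) *\<^sub>R y"
    have "u \<in> P" unfolding u_def
      using False by (intro convexD[OF \<open>convex P\<close> xy(1,2)]) (auto simp: add_divide_distrib[symmetric])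
    moreover have "of_int_vec (p + q) = real (m + m') *\<^sub>R u"
      using False by (simp add: u_def xy of_int_vec_add scaleR_add_right del: of_nat_add)
    ultimately show ?thesis by (auto simp: dilate_points_def)
  qed
qed

lemma zero_in_dilate_points_0:
  assumes "lattice_polytope P"
  shows "0 \<in> dilate_points P 0"
proof -
  have "P \<noteq> {}" using assms by (auto simp: lattice_polytope_def)
  then obtain x where "x \<in> P" by blast
  thus ?thesis by (auto simp: dilate_points_def of_int_vec_def vec_eq_iff)
qed

subsection \<open>Cosets of the filtration\<close>

text \<open>
  The coset of \<open>F\<^bsub>m,d+1\<^esub>\<close> in \<open>F\<^bsub>m,d\<^esub>\<close> with leading form \<open>g\<close>. It is empty if no element has leading form \<open>g\<close>,
  so nonemptiness encodes that \<open>g\<close> is harmonic and homogeneous of degree \<open>d\<close>.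
\<close>

definition leading_coset :: "(real ^ 'n::finite) set \<Rightarrow> nat \<Rightarrow> nat \<Rightarrow> 'n cpoly \<Rightarrow> 'n laurent poly set" where
  "leading_coset P m d g = {monom f m | f. keys f \<subseteq> dilate_points P m \<and> (\<forall>j<d. exp_part j f = 0) \<and> exp_part d f = g}"

lemma filt_eq:
  "filt P m d = {monom f m | f. keys f \<subseteq> dilate_points P m \<and> (\<forall>j<d. exp_part j f = 0)}"
proof -
  have "monom f m \<in> semigroup_algebra P \<longleftrightarrow> keys f \<subseteq> dilate_points P m" for f
    by (auto simp: semigroup_algebra_def)
  thus ?thesis unfolding filt_def vanishing_order_ge_iff by blast
qed

lemma leading_coset_0: "leading_coset P m d 0 = filt P m (Suc d)"
  by (auto simp: leading_coset_def filt_eq less_Suc_eq)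

text \<open>Two elements with the same leading form differ by one that vanishes to order
  \<open>d + 1\<close>.\<close>

lemma leading_coset_eq:
  fixes P :: "(real ^ 'n::finite) set"
  assumes "a \<in> leading_coset P m d g"
  shows "a +o filt P m (Suc d) = leading_coset P m d g"
proof -
  obtain f where f: "a = monom f m" "keys f \<subseteq> dilate_points P m" "\<And>j. j < d \<Longrightarrow> exp_part j f = 0" "exp_part d f = g"
    using assms by (auto simp: leading_coset_def)
  show ?thesis
  proof (intro equalityI subsetI)
    fix x assume "x \<in> a +o filt P m (Suc d)"
    then obtain h where h: "x = monom (f + h) m" "keys h \<subseteq> dilate_points P m" "\<And>j. j < Suc d \<Longrightarrow> exp_part j h = 0"
      by (auto simp: elt_set_plus_def filt_eq f(1) add_monom)
    moreover have "keys (f + h) \<subseteq> dilate_points P m"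
      using Poly_Mapping.keys_add[of f h] f h by blast
    ultimately show "x \<in> leading_coset P m d g"
      using f by (auto simp: leading_coset_def exp_part_add)
  next
    fix x assume "x \<in> leading_coset P m d g"
    then obtain h where h: "x = monom h m" "keys h \<subseteq> dilate_points P m" "\<And>j. j < d \<Longrightarrow> exp_part j h = 0" "exp_part d h = g"
      by (auto simp: leading_coset_def)
    have "keys (h - f) \<subseteq> dilate_points P m"
      using f(2) h(2) Poly_Mapping.keys_diff[of h f] by blast
    moreover have "exp_part j (h - f) = 0" if "j < Suc d" for j
      using that f h by (auto simp: exp_part_diff less_Suc_eq)
    ultimately have "monom (h - f) m \<in> filt P m (Suc d)" by (auto simp: filt_eq)
    moreover have "x = a + monom (h - f) m" by (simp add: h f add_monom)
    ultimately show "x \<in> a +o filt P m (Suc d)" by (auto simp: elt_set_plus_def)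
  qed
qed

text \<open>Nonemptiness is essential: every unattained leading form gives the empty set.\<close>

lemma leading_coset_inject:
  assumes "leading_coset P m d g = leading_coset P m d g'" "leading_coset P m d g \<noteq> {}"
  shows "g = g'"
proof -
  obtain a where "a \<in> leading_coset P m d g" "a \<in> leading_coset P m d g'" using assms by blast
  thus ?thesis unfolding leading_coset_def by auto
qed

lemma leading_coset_mem_add:
  assumes "a \<in> leading_coset P m d g" "b \<in> leading_coset P m d h"
  shows "a + b \<in> leading_coset P m d (g + h)"
proof -
  obtain u v where u: "a = monom u m" "keys u \<subseteq> dilate_points P m" "\<And>j. j < d \<Longrightarrow> exp_part j u = 0" "exp_part d u = g"
    and v: "b = monom v m" "keys v \<subseteq> dilate_points P m" "\<And>j. j < d \<Longrightarrow> exp_part j v = 0" "exp_part d v = h"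
    using assms by (auto simp: leading_coset_def)
  have "keys (u + v) \<subseteq> dilate_points P m"
    using Poly_Mapping.keys_add[of u v] u v by blast
  thus ?thesis using u v by (auto simp: leading_coset_def exp_part_add add_monom)
qed

lemma leading_coset_add:
  assumes "leading_coset P m d g \<noteq> {}" "leading_coset P m d h \<noteq> {}"
  shows "leading_coset P m d g + leading_coset P m d h = leading_coset P m d (g + h)"
proof -
  obtain a b where ab: "a \<in> leading_coset P m d g" "b \<in> leading_coset P m d h" using assms by blast
  have "leading_coset P m d g + leading_coset P m d h \<subseteq> leading_coset P m d (g + h)"
    by (auto simp: set_plus_def intro: leading_coset_mem_add)
  \<comment> \<open>For the converse inclusion a single translate already fills the target
    coset.\<close>
  moreover have "leading_coset P m d (g + h) = a +o leading_coset P m d h"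
    unfolding leading_coset_eq[OF ab(2), symmetric] leading_coset_eq[OF leading_coset_mem_add[OF ab], symmetric]
    by (simp add: set_plus_rearrange2)
  hence "leading_coset P m d (g + h) \<subseteq> leading_coset P m d g + leading_coset P m d h"
    using ab(1) by (auto simp: set_plus_def elt_set_plus_def)
  ultimately show ?thesis by blast
qed

text \<open>The empty sum of sets is \<open>{0}\<close>, which need not be a coset; hence
  \<open>I \<noteq> {}\<close>. Nonemptiness of the result is carried along because adding the next
  coset requires it.\<close>

lemma leading_coset_sum:
  assumes "finite I" "I \<noteq> {}" "\<And>i. i \<in> I \<Longrightarrow> leading_coset P m d (g i) \<noteq> {}"
  shows "(\<Sum>i\<in>I. leading_coset P m d (g i)) = leading_coset P m d (\<Sum>i\<in>I. g i) \<and> leading_coset P m d (\<Sum>i\<in>I. g i) \<noteq> {}"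
  using assms
proof (induction I rule: finite_ne_induct)
  case (insert i I)
  hence IH: "(\<Sum>i\<in>I. leading_coset P m d (g i)) = leading_coset P m d (\<Sum>i\<in>I. g i)" "leading_coset P m d (\<Sum>i\<in>I. g i) \<noteq> {}"
    and ne: "leading_coset P m d (g i) \<noteq> {}" by auto
  have "leading_coset P m d (g i + (\<Sum>i\<in>I. g i)) \<noteq> {}"
    using leading_coset_mem_add ne IH(2) by (metis all_not_in_conv)
  thus ?case using insert.hyps leading_coset_add[OF ne IH(2)] by (simp add: IH(1))
qed simp

lemma leading_coset_mem_mult:
  assumes "lattice_polytope P" "a \<in> leading_coset P m d g" "b \<in> leading_coset P m' d' h"
  shows "a * b \<in> leading_coset P (m + m') (d + d') (g * h)"
proof -
  obtain u v where u: "a = monom u m" "keys u \<subseteq> dilate_points P m" "\<And>j. j < d \<Longrightarrow> exp_part j u = 0" "exp_part d u = g"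
    and v: "b = monom v m'" "keys v \<subseteq> dilate_points P m'" "\<And>j. j < d' \<Longrightarrow> exp_part j v = 0" "exp_part d' v = h"
    using assms by (auto simp: leading_coset_def)
  have "keys (u * v) \<subseteq> dilate_points P (m + m')"
    using Poly_Mapping.keys_mult[of u v] u v dilate_points_add[OF assms(1)] by blast
  moreover note exp_part_mult_vanishing[of d u d' v]
  ultimately show ?thesis using u v by (auto simp: leading_coset_def mult_monom)
qed

text \<open>All members of the union are the same coset, and nonempty factors ensure that the union
  has members.\<close>

lemma coset_mult_leading_coset:
  assumes "lattice_polytope P" "leading_coset P m d g \<noteq> {}" "leading_coset P m' d' h \<noteq> {}"
  shows "coset_mult P (m, d) (m', d') (leading_coset P m d g) (leading_coset P m' d' h) = leading_coset P (m + m') (d + d') (g * h)"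
proof -
  have "(\<Union>a\<in>leading_coset P m d g. \<Union>b\<in>leading_coset P m' d' h. (a * b) +o filt P (m + m') (Suc (d + d'))) =
    (\<Union>a\<in>leading_coset P m d g. \<Union>b\<in>leading_coset P m' d' h. leading_coset P (m + m') (d + d') (g * h))"
    by (intro SUP_cong refl leading_coset_eq leading_coset_mem_mult[OF assms(1)])
  thus ?thesis using assms(2,3) by (simp add: coset_mult_def)
qed

lemma leading_coset_mem_scale:
  assumes "a \<in> leading_coset P m d g"
  shows "scale c a \<in> leading_coset P m d (const c * g)"
proof -
  obtain u where u: "a = monom u m" "keys u \<subseteq> dilate_points P m" "\<And>j. j < d \<Longrightarrow> exp_part j u = 0" "exp_part d u = g"
    using assms by (auto simp: leading_coset_def)
  have "keys (const c * u) \<subseteq> dilate_points P m"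
    using u(2) by (auto simp: in_keys_iff)
  thus ?thesis using u by (auto simp: leading_coset_def scale_def smult_monom exp_part_const_mult)
qed

lemma coset_scale_leading_coset:
  assumes "leading_coset P m d g \<noteq> {}"
  shows "coset_scale P (m, d) c (leading_coset P m d g) = leading_coset P m d (const c * g)"
proof -
  have "(\<Union>a\<in>leading_coset P m d g. scale c a +o filt P m (Suc d)) = (\<Union>a\<in>leading_coset P m d g. leading_coset P m d (const c * g))"
    by (intro SUP_cong refl leading_coset_eq leading_coset_mem_scale)
  thus ?thesis using assms by (simp add: coset_scale_def)
qed

lemma leading_coset_nonempty:
  assumes "lattice_polytope P" "g \<in> dilate_harmonics P m" "homogeneous d g"
  shows "leading_coset P m d g \<noteq> {}"
proof -
  obtain f where "keys f \<subseteq> dilate_points P m" "\<And>j. j < d \<Longrightarrow> exp_part j f = 0" "exp_part d f = g"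
    using harmonic_space_imp_exp_part[OF finite_dilate_points[OF assms(1)] assms(2,3)] by blast
  thus ?thesis by (auto simp: leading_coset_def)
qed

lemma leading_coset_nonempty_imp_harmonic:
  assumes "leading_coset P m d g \<noteq> {}"
  shows "g \<in> dilate_harmonics P m" "homogeneous d g"
proof -
  obtain f where f: "keys f \<subseteq> dilate_points P m" "\<And>j. j < d \<Longrightarrow> exp_part j f = 0" "g = exp_part d f"
    using assms unfolding leading_coset_def by blast
  show "g \<in> dilate_harmonics P m" unfolding f(3) by (rule exp_part_in_harmonic_space[OF f(1,2)])
  show "homogeneous d g" unfolding f(3) by (rule homogeneous_exp_part)
qed

lemma filt_quot_eq: "filt_quot P m d = {leading_coset P m d g | g. leading_coset P m d g \<noteq> {}}"
proof (intro equalityI subsetI)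
  fix U assume "U \<in> filt_quot P m d"
  then obtain a where a: "a \<in> filt P m d" "U = a +o filt P m (Suc d)"
    unfolding filt_quot_def by blast
  obtain f where f: "a = monom f m" "keys f \<subseteq> dilate_points P m" "\<forall>j<d. exp_part j f = 0"
    using a(1) unfolding filt_eq by blast
  have *: "a \<in> leading_coset P m d (exp_part d f)" unfolding leading_coset_def using f by blast
  have "U = leading_coset P m d (exp_part d f)" unfolding a(2) by (rule leading_coset_eq[OF *])
  thus "U \<in> {leading_coset P m d g | g. leading_coset P m d g \<noteq> {}}" using * by blast
next
  fix U assume "U \<in> {leading_coset P m d g | g. leading_coset P m d g \<noteq> {}}"
  then obtain g a where U: "U = leading_coset P m d g" "a \<in> leading_coset P m d g" by blast
  have "a \<in> filt P m d" using U(2) unfolding leading_coset_def filt_eq by blast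
  moreover have "U = a +o filt P m (Suc d)" unfolding U(1) by (rule leading_coset_eq[OF U(2), symmetric])
  ultimately show "U \<in> filt_quot P m d" unfolding filt_quot_def by blast
qed


subsection \<open>The harmonic algebra\<close>

text \<open>Homogeneous parts are lifted to Laurent polynomials. The product of two lifts is
  supported on the dilate by \<open>m + m'\<close> and has the product of the parts as its lowest
  part, which is therefore harmonic.\<close>

lemma harmonic_mult:
  fixes P :: "(real ^ 'n::finite) set"
  assumes P: "lattice_polytope P" and f: "f \<in> dilate_harmonics P m" and g: "g \<in> dilate_harmonics P m'"
  shows "f * g \<in> dilate_harmonics P (m + m')"
proof -
  have "homogeneous_part d f * homogeneous_part d' g \<in> dilate_harmonics P (m + m')" for d d'
  proof -
    have "leading_coset P m d (homogeneous_part d f) \<noteq> {}" "leading_coset P m' d' (homogeneous_part d' g) \<noteq> {}"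
      by (intro leading_coset_nonempty[OF P] homogeneous_part_in_harmonic_space f g homogeneous_homogeneous_part)+
    thus ?thesis
      using leading_coset_mem_mult[OF P] leading_coset_nonempty_imp_harmonic(1) by (metis all_not_in_conv)
  qed
  hence "(\<Sum>d\<in>tdeg ` keys f. homogeneous_part d f) * (\<Sum>d\<in>tdeg ` keys g. homogeneous_part d g)
    \<in> dilate_harmonics P (m + m')"
    unfolding sum_product by (intro harmonic_space_sum) auto
  thus ?thesis by (simp add: sum_homogeneous_part)
qed

lemma one_in_leading_coset:
  assumes "lattice_polytope P"
  shows "1 \<in> leading_coset P 0 0 1"
proof -
  have "exp_part 0 1 = (1 :: 'a cpoly)" using exp_part_single[of 0 0 1] by simp
  moreover have "keys (1 :: 'a laurent) \<subseteq> dilate_points P 0"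
    using zero_in_dilate_points_0[OF assms] by simp
  moreover have "(1 :: 'a laurent poly) = monom 1 0" by (simp add: monom_0)
  ultimately show ?thesis unfolding leading_coset_def by blast
qed

lemma harmonic_one:
  assumes "lattice_polytope P"
  shows "1 \<in> dilate_harmonics P 0"
  using one_in_leading_coset[OF assms] leading_coset_nonempty_imp_harmonic(1) by blast

section \<open>Scalars and bihomogeneous decompositions\<close>

lemma coeff_scale: "coeff (scale c F) m = const c * coeff F m"
  by (simp add: scale_def)

lemma scale_simps:
  fixes F :: "('e::comm_monoid_add \<Rightarrow>\<^sub>0 complex) poly"
  shows "scale (a + b) F = scale a F + scale b F" "scale a (F + G) = scale a F + scale a G"
    "scale (a * b) F = scale a (scale b F)" "scale 1 F = F" "scale a F * G = scale a (F * G)"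
  by (simp_all add: scale_def single_add smult_add_left smult_add_right mult_single)

lemma homogeneous_1 [simp]: "homogeneous 0 (1 :: 'n::finite cpoly)"
  by (simp add: homogeneous_def)

lemma homogeneous_0 [simp]: "homogeneous d 0"
  by (simp add: homogeneous_def)

lemma homogeneous_add: "homogeneous d f \<Longrightarrow> homogeneous d g \<Longrightarrow> homogeneous d (f + g)"
  by (simp add: homogeneous_iff lookup_add)

lemma homogeneous_const_mult: "homogeneous d f \<Longrightarrow> homogeneous d (const c * f)"
  by (simp add: homogeneous_iff)

lemma homogeneous_mult:
  assumes "homogeneous d f" "homogeneous d' g"
  shows "homogeneous (d + d') (f * g)"
  using Poly_Mapping.keys_mult[of f g] assms unfolding homogeneous_def
  by (auto simp: tdeg_add dest!: subsetD)

lemma scale_neg_1: "scale (-1) F = - (F :: 'n::finite cpoly poly)"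
  by (rule poly_eqI) (simp add: coeff_scale const_uminus_one_mult)

text \<open>Recovers the terms of a bihomogeneous sum; this serves both uniqueness of decompositions
  and surjectivity of the isomorphism.\<close>

lemma homogeneous_part_sum_components:
  fixes c :: "nat \<times> nat \<Rightarrow> 'n::finite cpoly poly"
  assumes "finite I" "\<And>m d. \<exists>g. homogeneous d g \<and> c (m, d) = monom g m" "\<And>i. i \<notin> I \<Longrightarrow> c i = 0"
  shows "homogeneous_part d (coeff (\<Sum>i\<in>I. c i) m) = coeff (c (m, d)) m"
proof -
  have "\<forall>i. \<exists>g. homogeneous (snd i) g \<and> c i = monom g (fst i)"
    using assms(2) by (simp add: split_paired_all)
  from choice[OF this] obtain g where g: "\<And>i. homogeneous (snd i) (g i)" "\<And>i. c i = monom (g i) (fst i)"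
    by blast
  have "homogeneous_part d (coeff (c i) m) = (if i = (m, d) then coeff (c (m, d)) m else 0)" for i
    by (cases i) (auto simp: g(2) homogeneous_part_homogeneous[OF g(1)])
  thus ?thesis using assms(1) assms(3)[of "(m, d)"]
    by (simp add: coeff_sum homogeneous_part_sum)
qed

lemma nonzero_homogeneous_parts_subset:
  "{(m, d). homogeneous_part d (coeff F m) \<noteq> 0} \<subseteq> Sigma {..degree F} (\<lambda>m. tdeg ` keys (coeff F m))"
proof clarify
  fix m d assume ne: "homogeneous_part d (coeff F m) \<noteq> 0"
  then obtain a where "lookup (homogeneous_part d (coeff F m)) a \<noteq> 0"
    by (metis poly_mapping_eqI lookup_zero)
  hence "tdeg a = d" "a \<in> keys (coeff F m)"
    by (auto simp: lookup_homogeneous_part in_keys_iff split: if_splits)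
  moreover have "m \<le> degree F" using ne by (intro le_degree) auto
  ultimately show "m \<in> {..degree F} \<and> d \<in> tdeg ` keys (coeff F m)" by auto
qed

lemma finite_nonzero_homogeneous_parts: "finite {(m, d). homogeneous_part d (coeff F m) \<noteq> 0}"
  by (rule finite_subset[OF nonzero_homogeneous_parts_subset]) auto

lemma cring_harmonic_algebra:
  assumes P: "lattice_polytope P"
  shows "cring (harmonic_algebra P)"
proof (rule cringI)
  have uminus: "- F \<in> carrier (harmonic_algebra P)" if "F \<in> carrier (harmonic_algebra P)" for F
    using that by (auto simp: harmonic_algebra_def harmonic_space_uminus)
  show "abelian_group (harmonic_algebra P)"
  proof (rule abelian_groupI)
    fix x assume "x \<in> carrier (harmonic_algebra P)"
    thus "\<exists>y\<in>carrier (harmonic_algebra P). y \<oplus>\<^bsub>harmonic_algebra P\<^esub> x = \<zero>\<^bsub>harmonic_algebra P\<^esub>"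
      using uminus by (intro bexI[of _ "- x"]) (auto simp: harmonic_algebra_def)
  qed (auto simp: harmonic_algebra_def harmonic_space_add add_ac)
  show "comm_monoid (harmonic_algebra P)"
  proof (rule comm_monoidI)
    fix x y assume "x \<in> carrier (harmonic_algebra P)" "y \<in> carrier (harmonic_algebra P)"
    hence x: "coeff x m \<in> dilate_harmonics P m" and y: "coeff y m \<in> dilate_harmonics P m" for m
      by (auto simp: harmonic_algebra_def)
    have "coeff x i * coeff y (m - i) \<in> dilate_harmonics P m" if "i \<le> m" for i m
      using harmonic_mult[OF P x[of i] y[of "m - i"]] that by simp
    thus "x \<otimes>\<^bsub>harmonic_algebra P\<^esub> y \<in> carrier (harmonic_algebra P)"
      by (auto simp: harmonic_algebra_def coeff_mult intro!: harmonic_space_sum)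
  next
    show "\<one>\<^bsub>harmonic_algebra P\<^esub> \<in> carrier (harmonic_algebra P)"
      using harmonic_one[OF P] by (auto simp: harmonic_algebra_def coeff_1)
  qed (auto simp: harmonic_algebra_def mult_ac)
qed (auto simp: harmonic_algebra_def algebra_simps)

lemma bigraded_algebra_harmonic_algebra:
  fixes P :: "(real ^ 'n::finite) set"
  assumes P: "lattice_polytope P"
  shows "bigraded_algebra (harmonic_algebra P)"
proof -
  let ?H = "harmonic_algebra P"
  interpret H: cring ?H by (rule cring_harmonic_algebra[OF P])
  have "algebra (univ_ring :: complex ring) ?H"
    by (rule algebraI[OF cring_univ_ring cring_harmonic_algebra[OF P]])
      (auto simp: harmonic_algebra_def univ_ring_def harmonic_space_const_mult coeff_scale scale_simps)
  note algH = this
  then interpret algebra "univ_ring :: complex ring" ?H .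
  have comp: "component ?H m d = {monom g m | g. g \<in> dilate_harmonics P m \<and> homogeneous d g}" for m d
    by (simp add: harmonic_algebra_def)
  have comp_carrier: "component ?H m d \<subseteq> carrier ?H" for m d
    by (auto simp: harmonic_algebra_def)
  have zeroH: "\<zero>\<^bsub>?H\<^esub> = 0" and addH: "\<And>x y. x \<oplus>\<^bsub>?H\<^esub> y = x + y"
    by (simp_all add: harmonic_algebra_def)
  have finsum: "finsum ?H c I = (\<Sum>i\<in>I. c i)" if "finite I" "\<And>i. i \<in> I \<Longrightarrow> c i \<in> carrier ?H"
    for c :: "nat \<times> nat \<Rightarrow> 'n cpoly poly" and I
    using that by (induction I rule: finite_induct) (auto simp: H.finsum_insert Pi_def zeroH addH)
  show ?thesis
  proof (rule bigraded_algebra.intro[OF algH bigraded_algebra_axioms.intro])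
    fix m d
    have scale_comp: "scale c x \<in> component ?H m d" if "x \<in> component ?H m d" for c x
      using that by (auto simp: comp scale_def smult_monom harmonic_space_const_mult homogeneous_const_mult)
    show "submodule (component ?H m d) (univ_ring :: complex ring) ?H"
    proof (rule submoduleI)
      fix x assume x: "x \<in> component ?H m d"
      have "\<ominus>\<^bsub>?H\<^esub> x = - x"
      proof (rule H.minus_equality)
        show "- x \<in> carrier ?H" using scale_comp[OF x, of "-1"] comp_carrier by (auto simp: scale_neg_1)
      qed (use x comp_carrier in \<open>auto simp: harmonic_algebra_def\<close>)
      thus "\<ominus>\<^bsub>?H\<^esub> x \<in> component ?H m d" using scale_comp[OF x, of "-1"] by (simp add: scale_neg_1)
    next
      fix x y assume "x \<in> component ?H m d" "y \<in> component ?H m d"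
      thus "x \<oplus>\<^bsub>?H\<^esub> y \<in> component ?H m d"
        by (auto simp: harmonic_algebra_def add_monom harmonic_space_add homogeneous_add)
    next
      fix a :: complex and x assume "x \<in> component ?H m d"
      thus "a \<odot>\<^bsub>?H\<^esub> x \<in> component ?H m d" using scale_comp[of x a] by (simp add: harmonic_algebra_def)
    next
      show "\<zero>\<^bsub>?H\<^esub> \<in> component ?H m d" by (auto simp: harmonic_algebra_def intro!: exI[of _ 0])
    qed (rule comp_carrier)
  next
    show "\<one>\<^bsub>?H\<^esub> \<in> component ?H 0 0"
      using harmonic_one[OF P] by (auto simp: harmonic_algebra_def monom_0 intro!: exI[of _ 1])
  next
    fix x y m d m' d' assume "x \<in> component ?H m d" "y \<in> component ?H m' d'"
    thus "x \<otimes>\<^bsub>?H\<^esub> y \<in> component ?H (m + m') (d + d')"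
      by (auto simp: harmonic_algebra_def mult_monom harmonic_mult[OF P] homogeneous_mult)
  next
    fix x assume x: "x \<in> carrier ?H"
    let ?R = "\<lambda>c. (\<forall>m d. c (m, d) \<in> component ?H m d) \<and> finite {i. c i \<noteq> \<zero>\<^bsub>?H\<^esub>} \<and>
        x = (\<Oplus>\<^bsub>?H\<^esub>i\<in>{i. c i \<noteq> \<zero>\<^bsub>?H\<^esub>}. c i)"
    have zero: "\<zero>\<^bsub>?H\<^esub> = 0" by (simp add: harmonic_algebra_def)
    have R: "?R c \<longleftrightarrow> (\<forall>m d. c (m, d) \<in> component ?H m d) \<and> finite {i. c i \<noteq> 0} \<and> x = (\<Sum>i\<in>{i. c i \<noteq> 0}. c i)" for c
    proof (cases "(\<forall>m d. c (m, d) \<in> component ?H m d) \<and> finite {i. c i \<noteq> 0}")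
      case True
      hence "c i \<in> carrier ?H" for i using comp_carrier by (cases i) blast
      thus ?thesis using True finsum[of "{i. c i \<noteq> 0}" c] by (simp add: zero)
    qed (auto simp: zero)
    define c where "c = (\<lambda>(m, d). monom (homogeneous_part d (coeff x m)) m)"
    show "\<exists>!c. ?R c"
      unfolding R
    proof (rule ex1I[of _ c])
      have "c (m, d) \<in> component ?H m d" for m d
        using x by (auto simp: c_def harmonic_algebra_def homogeneous_part_in_harmonic_space)
      \<comment> \<open>A finite set containing the support, shaped so that the sum can be taken
        over \<open>d\<close> first and then over \<open>m\<close>.\<close>
      moreover define S where "S = Sigma {..degree x} (\<lambda>m. tdeg ` keys (coeff x m))"
      have "finite S" by (auto simp: S_def)
      moreover have sub: "{i. c i \<noteq> 0} \<subseteq> S"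
        using nonzero_homogeneous_parts_subset[of x] unfolding S_def by (force simp: c_def)
      moreover have "x = (\<Sum>i\<in>{i. c i \<noteq> 0}. c i)"
      proof -
        have "(\<Sum>i\<in>{i. c i \<noteq> 0}. c i) = (\<Sum>i\<in>S. c i)"
          using \<open>finite S\<close> sub by (intro sum.mono_neutral_left) auto
        also have "\<dots> = (\<Sum>m\<le>degree x. \<Sum>d\<in>tdeg ` keys (coeff x m). c (m, d))"
          unfolding S_def by (subst sum.Sigma) auto
        also have "\<dots> = (\<Sum>m\<le>degree x. monom (coeff x m) m)"
          by (intro sum.cong) (simp_all add: c_def sum_homogeneous_part flip: monom_sum)
        finally show ?thesis by (simp add: poly_as_sum_of_monoms)
      qed
      ultimately show "(\<forall>m d. c (m, d) \<in> component ?H m d) \<and> finite {i. c i \<noteq> 0} \<and> x = (\<Sum>i\<in>{i. c i \<noteq> 0}. c i)"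
        using finite_subset by blast
    next
      fix c' assume c': "(\<forall>m d. c' (m, d) \<in> component ?H m d) \<and> finite {i. c' i \<noteq> 0} \<and> x = (\<Sum>i\<in>{i. c' i \<noteq> 0}. c' i)"
      show "c' = c"
      proof
        fix i :: "nat \<times> nat"
        obtain m d where i: "i = (m, d)" by (cases i)
        have "homogeneous_part d (coeff (\<Sum>i\<in>{i. c' i \<noteq> 0}. c' i) m) = coeff (c' (m, d)) m"
        proof (rule homogeneous_part_sum_components)
          fix m d
          have "c' (m, d) \<in> component ?H m d" using c' by blast
          thus "\<exists>g. homogeneous d g \<and> c' (m, d) = monom g m" unfolding comp by blast
        qed (use c' in auto)
        hence "homogeneous_part d (coeff x m) = coeff (c' (m, d)) m" using c' by simp
        moreover have "c' (m, d) = monom (coeff (c' (m, d)) m) m"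
        proof -
          have "c' (m, d) \<in> component ?H m d" using c' by blast
          then obtain g where "c' (m, d) = monom g m" by (auto simp: comp)
          thus ?thesis by simp
        qed
        ultimately show "c' i = c i" by (simp add: i c_def)
      qed
    qed
  qed
qed


subsection \<open>The isomorphism\<close>

text \<open>The inverse of taking lowest parts. In this direction no representatives of cosets need
  to be chosen.\<close>

definition coset_family ::
  "(real ^ 'n::finite) set \<Rightarrow> 'n cpoly poly \<Rightarrow> nat \<times> nat \<Rightarrow> 'n laurent poly set" where
  "coset_family P F = (\<lambda>(m, d). leading_coset P m d (homogeneous_part d (coeff F m)))"

text \<open>Every harmonic form is attained as a leading form; this discharges the nonemptiness
  conditions of the coset lemmas.\<close>

lemma leading_coset_homogeneous_part_nonempty:
  assumes "lattice_polytope P" "F \<in> carrier (harmonic_algebra P)"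
  shows "leading_coset P m d (homogeneous_part d (coeff F m)) \<noteq> {}"
  using assms(2) by (intro leading_coset_nonempty[OF assms(1)] homogeneous_part_in_harmonic_space)
    (simp_all add: harmonic_algebra_def)

lemma poly_eq_homogeneous_parts:
  assumes "\<And>m d. homogeneous_part d (coeff F m) = homogeneous_part d (coeff G m)"
  shows "F = G"
proof (rule poly_eqI, rule poly_mapping_eqI)
  fix m a
  show "lookup (coeff F m) a = lookup (coeff G m) a"
    using arg_cong[OF assms[of "tdeg a" m], of "\<lambda>f. lookup f a"] by (simp add: lookup_homogeneous_part)
qed

lemma coset_family_bij:
  fixes P :: "(real ^ 'n::finite) set"
  assumes P: "lattice_polytope P"
  shows "bij_betw (coset_family P) (carrier (harmonic_algebra P)) (gr_carrier P)"
proof (rule bij_betwI')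
  fix F G assume F: "F \<in> carrier (harmonic_algebra P)" and "G \<in> carrier (harmonic_algebra P)"
  show "coset_family P F = coset_family P G \<longleftrightarrow> F = G"
  proof
    assume eq: "coset_family P F = coset_family P G"
    show "F = G"
    proof (rule poly_eq_homogeneous_parts)
      fix m d
      show "homogeneous_part d (coeff F m) = homogeneous_part d (coeff G m)"
        using fun_cong[OF eq, of "(m, d)"]
        by (intro leading_coset_inject[OF _ leading_coset_homogeneous_part_nonempty[OF P F]]) (simp add: coset_family_def)
    qed
  qed simp
next
  fix F assume F: "F \<in> carrier (harmonic_algebra P)"
  have "{(m, d). coset_family P F (m, d) \<noteq> filt P m (Suc d)} \<subseteq> {(m, d). homogeneous_part d (coeff F m) \<noteq> 0}"
    by (auto simp: coset_family_def leading_coset_0)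
  hence "finite {(m, d). coset_family P F (m, d) \<noteq> filt P m (Suc d)}"
    using finite_nonzero_homogeneous_parts finite_subset by blast
  moreover have "coset_family P F (m, d) \<in> filt_quot P m d" for m d
    using leading_coset_homogeneous_part_nonempty[OF P F, of m d] unfolding filt_quot_eq coset_family_def by auto
  ultimately show "coset_family P F \<in> gr_carrier P" unfolding gr_carrier_def by blast
next
  fix u assume u: "u \<in> gr_carrier P"
  have "\<forall>i. \<exists>g. u i = leading_coset P (fst i) (snd i) g \<and> leading_coset P (fst i) (snd i) g \<noteq> {}"
  proof
    fix i
    have "u (fst i, snd i) \<in> filt_quot P (fst i) (snd i)" using u unfolding gr_carrier_def by blast
    thus "\<exists>g. u i = leading_coset P (fst i) (snd i) g \<and> leading_coset P (fst i) (snd i) g \<noteq> {}"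
      unfolding filt_quot_eq by auto
  qed
  from choice[OF this] obtain g where g: "\<And>i. u i = leading_coset P (fst i) (snd i) (g i)"
    "\<And>i. leading_coset P (fst i) (snd i) (g i) \<noteq> {}" by blast
  have g_harm: "g (m, d) \<in> dilate_harmonics P m" "homogeneous d (g (m, d))" for m d
    using leading_coset_nonempty_imp_harmonic[OF g(2)[of "(m, d)"]] by simp_all
  define I where "I = {(m, d). u (m, d) \<noteq> filt P m (Suc d)}"
  have fin: "finite I" using u unfolding gr_carrier_def I_def by blast
  \<comment> \<open>Off the finite support the coset is the one with leading form \<open>0\<close>,
    so the chosen forms have finite support too and can be summed to \<open>F\<close>.\<close>
  have g0: "g i = 0" if "i \<notin> I" for i
  proof (rule leading_coset_inject[OF _ g(2)])
    show "leading_coset P (fst i) (snd i) (g i) = leading_coset P (fst i) (snd i) 0"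
      using that g(1)[of i] by (cases i) (simp add: I_def leading_coset_0)
  qed
  define c where "c = (\<lambda>i. monom (g i) (fst i))"
  define F where "F = (\<Sum>i\<in>I. c i)"
  have hp: "homogeneous_part d (coeff F m) = g (m, d)" for m d
  proof -
    have "homogeneous_part d (coeff F m) = coeff (c (m, d)) m" unfolding F_def
      by (rule homogeneous_part_sum_components[OF fin]) (use g_harm g0 in \<open>auto simp: c_def\<close>)
    thus ?thesis by (simp add: c_def)
  qed
  have "coeff F m \<in> dilate_harmonics P m" for m
    unfolding F_def coeff_sum
    by (rule harmonic_space_sum) (use g_harm in \<open>auto simp: c_def\<close>)
  hence "F \<in> carrier (harmonic_algebra P)" by (simp add: harmonic_algebra_def)
  moreover have "u = coset_family P F"
    by (auto simp: fun_eq_iff coset_family_def hp g(1))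
  ultimately show "\<exists>F\<in>carrier (harmonic_algebra P). u = coset_family P F" by blast
qed

lemma coset_family_mult:
  fixes P :: "(real ^ 'n::finite) set"
  assumes P: "lattice_polytope P"
    and F: "F \<in> carrier (harmonic_algebra P)" and G: "G \<in> carrier (harmonic_algebra P)"
  shows "coset_family P (F * G) = coset_family P F \<otimes>\<^bsub>gr_algebra P\<^esub> coset_family P G"
proof (rule ext, clarify)
  fix m d
  \<comment> \<open>One term of the double Cauchy product, in the degree of \<open>z\<close> and in
    the polynomial degree.\<close>
  define q where "q = (\<lambda>(i, j). homogeneous_part j (coeff F i) * homogeneous_part (d - j) (coeff G (m - i)))"
  have q: "coset_mult P (i, j) (m - i, d - j) (coset_family P F (i, j)) (coset_family P G (m - i, d - j)) =
      leading_coset P m d (q (i, j))" "leading_coset P m d (q (i, j)) \<noteq> {}" if "i \<le> m" "j \<le> d" for i j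
  proof -
    note ne = leading_coset_homogeneous_part_nonempty[OF P F, of i j] leading_coset_homogeneous_part_nonempty[OF P G, of "m - i" "d - j"]
    show "coset_mult P (i, j) (m - i, d - j) (coset_family P F (i, j)) (coset_family P G (m - i, d - j)) =
      leading_coset P m d (q (i, j))"
      using coset_mult_leading_coset[OF P ne] that by (simp add: coset_family_def q_def)
    obtain a b where "a \<in> leading_coset P i j (homogeneous_part j (coeff F i))"
      "b \<in> leading_coset P (m - i) (d - j) (homogeneous_part (d - j) (coeff G (m - i)))"
      using ne by blast
    from leading_coset_mem_mult[OF P this] that show "leading_coset P m d (q (i, j)) \<noteq> {}" by (auto simp: q_def)
  qed
  have "(coset_family P F \<otimes>\<^bsub>gr_algebra P\<^esub> coset_family P G) (m, d) =
    (\<Sum>(i, j)\<in>{..m} \<times> {..d}. coset_mult P (i, j) (m - i, d - j) (coset_family P F (i, j)) (coset_family P G (m - i, d - j)))"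
    by (simp add: gr_algebra_def)
  also have "\<dots> = (\<Sum>p\<in>{..m} \<times> {..d}. leading_coset P m d (q p))"
    by (rule sum.cong[OF refl]) (use q(1) in auto)
  also have "\<dots> = leading_coset P m d (\<Sum>p\<in>{..m} \<times> {..d}. q p)"
    using leading_coset_sum[of "{..m} \<times> {..d}" P m d q] q(2) by auto
  also have "(\<Sum>p\<in>{..m} \<times> {..d}. q p) = homogeneous_part d (coeff (F * G) m)"
    by (simp add: coeff_mult homogeneous_part_sum homogeneous_part_mult sum.cartesian_product q_def)
  finally show "coset_family P (F * G) (m, d) = (coset_family P F \<otimes>\<^bsub>gr_algebra P\<^esub> coset_family P G) (m, d)"
    by (simp add: coset_family_def)
qed

text \<open>Both memberships say that all homogeneous parts outside bidegree \<open>(m, d)\<close>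
  are zero, since a trivial coset has leading form \<open>0\<close>.\<close>

lemma coset_family_component:
  fixes P :: "(real ^ 'n::finite) set"
  assumes P: "lattice_polytope P"
  shows "coset_family P ` component (harmonic_algebra P) m d = component (gr_algebra P) m d"
proof -
  have comp: "F \<in> component (harmonic_algebra P) m d \<longleftrightarrow>
    (\<forall>m' d'. (m', d') \<noteq> (m, d) \<longrightarrow> coset_family P F (m', d') = filt P m' (Suc d'))"
    if F: "F \<in> carrier (harmonic_algebra P)" for F
  proof -
    have iff0: "coset_family P F (m', d') = filt P m' (Suc d') \<longleftrightarrow> homogeneous_part d' (coeff F m') = 0" for m' d'
      using leading_coset_inject[OF _ leading_coset_homogeneous_part_nonempty[OF P F], of m' d' 0]
      by (auto simp: coset_family_def leading_coset_0)
    have "(\<forall>m' d'. (m', d') \<noteq> (m, d) \<longrightarrow> homogeneous_part d' (coeff F m') = 0)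
      \<longleftrightarrow> F = monom (homogeneous_part d (coeff F m)) m" (is "?L \<longleftrightarrow> ?R")
    proof
      assume L: ?L
      show ?R by (rule poly_eq_homogeneous_parts) (use L in \<open>auto simp: homogeneous_part_homogeneous[OF homogeneous_homogeneous_part]\<close>)
    next
      assume R: ?R
      show ?L by (subst R) (auto simp: homogeneous_part_homogeneous[OF homogeneous_homogeneous_part])
    qed
    moreover have "F \<in> component (harmonic_algebra P) m d \<longleftrightarrow> F = monom (homogeneous_part d (coeff F m)) m"
    proof
      assume "F \<in> component (harmonic_algebra P) m d"
      then obtain g where "F = monom g m" "homogeneous d g" by (auto simp: harmonic_algebra_def)
      thus "F = monom (homogeneous_part d (coeff F m)) m" by (simp add: homogeneous_part_homogeneous)
    next
      assume "F = monom (homogeneous_part d (coeff F m)) m"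
      moreover have "homogeneous_part d (coeff F m) \<in> dilate_harmonics P m"
        using F by (simp add: harmonic_algebra_def homogeneous_part_in_harmonic_space)
      ultimately show "F \<in> component (harmonic_algebra P) m d"
        using homogeneous_homogeneous_part unfolding harmonic_algebra_def by auto
    qed
    ultimately show ?thesis unfolding iff0 by blast
  qed
  have sub: "component (harmonic_algebra P) m d \<subseteq> carrier (harmonic_algebra P)"
    by (auto simp: harmonic_algebra_def)
  have im: "coset_family P ` carrier (harmonic_algebra P) = gr_carrier P"
    using coset_family_bij[OF P] by (simp add: bij_betw_def)
  have gr: "component (gr_algebra P) m d = {u \<in> gr_carrier P. \<forall>m' d'. (m', d') \<noteq> (m, d) \<longrightarrow> u (m', d') = filt P m' (Suc d')}"
    by (simp add: gr_algebra_def)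
  show ?thesis unfolding gr im[symmetric] using sub comp by blast
qed

theorem theorem1p2:
  fixes P :: "(real ^ 'n::finite) set"
  assumes "lattice_polytope P"
  shows "bigraded_isomorphic (harmonic_algebra P) (gr_algebra P)"
proof (rule bigraded_isomorphicI)
  note P = assms
  show "bigraded_algebra (harmonic_algebra P)" by (rule bigraded_algebra_harmonic_algebra[OF P])
  show "bij_betw (coset_family P) (carrier (harmonic_algebra P)) (carrier (gr_algebra P))"
    using coset_family_bij[OF P] by (simp add: gr_algebra_def)
  show "coset_family P ` component (harmonic_algebra P) m d = component (gr_algebra P) m d" for m d
    by (rule coset_family_component[OF P])
  show "coset_family P \<zero>\<^bsub>harmonic_algebra P\<^esub> = \<zero>\<^bsub>gr_algebra P\<^esub>"
    by (auto simp: coset_family_def harmonic_algebra_def gr_algebra_def leading_coset_0)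
  show "coset_family P \<one>\<^bsub>harmonic_algebra P\<^esub> = \<one>\<^bsub>gr_algebra P\<^esub>"
  proof (rule ext, clarify)
    fix m d
    have "homogeneous_part d (coeff 1 m) = (if (m, d) = (0, 0) then 1 else 0 :: 'n cpoly)"
      by (auto simp: coeff_1 homogeneous_part_homogeneous[OF homogeneous_1])
    moreover have "1 +o filt P 0 (Suc 0) = leading_coset P 0 0 1"
      by (rule leading_coset_eq[OF one_in_leading_coset[OF P]])
    ultimately show "coset_family P \<one>\<^bsub>harmonic_algebra P\<^esub> (m, d) = \<one>\<^bsub>gr_algebra P\<^esub> (m, d)"
      by (auto simp: coset_family_def harmonic_algebra_def gr_algebra_def leading_coset_0)
  qed
next
  fix F G assume F: "F \<in> carrier (harmonic_algebra P)" and G: "G \<in> carrier (harmonic_algebra P)"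
  have mult: "F \<otimes>\<^bsub>harmonic_algebra P\<^esub> G = F * G" and add: "F \<oplus>\<^bsub>harmonic_algebra P\<^esub> G = F + G"
    by (simp_all add: harmonic_algebra_def)
  show "coset_family P (F \<otimes>\<^bsub>harmonic_algebra P\<^esub> G) = coset_family P F \<otimes>\<^bsub>gr_algebra P\<^esub> coset_family P G"
    unfolding mult by (rule coset_family_mult[OF assms F G])
  show "coset_family P (F \<oplus>\<^bsub>harmonic_algebra P\<^esub> G) = coset_family P F \<oplus>\<^bsub>gr_algebra P\<^esub> coset_family P G"
    unfolding add using leading_coset_add[OF leading_coset_homogeneous_part_nonempty[OF assms F] leading_coset_homogeneous_part_nonempty[OF assms G]]
    by (auto simp: fun_eq_iff coset_family_def gr_algebra_def homogeneous_part_add)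
next
  fix c F assume F: "F \<in> carrier (harmonic_algebra P)"
  show "coset_family P (c \<odot>\<^bsub>harmonic_algebra P\<^esub> F) = c \<odot>\<^bsub>gr_algebra P\<^esub> coset_family P F"
    using coset_scale_leading_coset[OF leading_coset_homogeneous_part_nonempty[OF assms F]]
    by (auto simp: fun_eq_iff coset_family_def harmonic_algebra_def gr_algebra_def coeff_scale homogeneous_part_const_mult)
qed

end
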